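(* If $S$ is a star or a binary caterpillar, then $J(S)=1$. Moreover, every topological tree $S$ that is neither a star nor a binary caterpillar satisfies $J(S)<1$.
   Context: A topological tree is a finite rooted tree in which every non-leaf vertex has outdegree (number of children) at least $2$; the single-vertex tree is allowed, its vertex being both root and leaf. Trees are considered up to isomorphism of rooted trees (unordered, unlabelled). $|T|$ denotes the number of leaves of $T$. A nonempty set $L$ of leaves of $T$ induces a topological tree: take the smallest subtree of $T$ connecting the leaves in $L$, rooted at the most recent common ancestor of $L$, and suppress (erase, joining the neighbours) all vertices of outdegree $1$. For topological trees $S,T$, $c(S,T)$ is the number of subsets of the leaf set of $T$ whose induced tree is isomorphic, as a rooted tree, to $S$, and $\gamma(S,T)=c(S,T)/\binom{|T|}{|S|}$ (for $|T|\ge |S|$). The inducibility of $S$ is $$J(S)=\limsup_{n\to\infty}\ \max_{\substack{|T|=n\\ T\text{ topological tree}}}\gamma(S,T).$$ A star is a topological tree in which all leaves are children of the root. A binary tree is a topological tree in which every vertex has outdegree at most $2$ (so every non-leaf vertex has exactly two children). A binary caterpillar is a binary tree whose non-leaf vertices all lie on a single path starting at the root (the single-vertex tree counts as a binary caterpillar). *)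

theory Defs
  imports Complex_Main "HOL-Library.Extended_Real"
begin

text \<open>Finite rooted trees are given by a vertex set, a root, and the set of edges, each directed
  from parent to child.\<close>

record 'a rtree =
  verts :: "'a set"
  edges :: "('a \<times> 'a) set"
  top_vertex :: 'a

definition rooted_tree :: "'a rtree \<Rightarrow> bool" where
  "rooted_tree T \<longleftrightarrow>
     finite (verts T) \<and> top_vertex T \<in> verts T \<and> edges T \<subseteq> verts T \<times> verts T \<and>
     (\<forall>u. (u, top_vertex T) \<notin> edges T) \<and>
     (\<forall>v \<in> verts T - {top_vertex T}. \<exists>!u. (u, v) \<in> edges T) \<and>
     (\<forall>v \<in> verts T. (top_vertex T, v) \<in> (edges T)\<^sup>*)"

definition children :: "'a rtree \<Rightarrow> 'a \<Rightarrow> 'a set" where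
  "children T v = {w. (v, w) \<in> edges T}"

abbreviation outdegree :: "'a rtree \<Rightarrow> 'a \<Rightarrow> nat" where
  "outdegree T v \<equiv> card (children T v)"

definition leaves :: "'a rtree \<Rightarrow> 'a set" where
  "leaves T = {v \<in> verts T. children T v = {}}"

definition topological_tree :: "'a rtree \<Rightarrow> bool" where
  "topological_tree T \<longleftrightarrow> rooted_tree T \<and> (\<forall>v \<in> verts T - leaves T. outdegree T v \<ge> 2)"

definition tree_iso :: "'a rtree \<Rightarrow> 'b rtree \<Rightarrow> bool" where
  "tree_iso S T \<longleftrightarrow>
     (\<exists>f. bij_betw f (verts S) (verts T) \<and> f (top_vertex S) = top_vertex T \<and>
          (\<forall>u \<in> verts S. \<forall>v \<in> verts S. (u, v) \<in> edges S \<longleftrightarrow> (f u, f v) \<in> edges T))"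

definition connected_in :: "'a rtree \<Rightarrow> 'a set \<Rightarrow> bool" where
  "connected_in T W \<longleftrightarrow>
     (\<forall>x \<in> W. \<forall>y \<in> W. (x, y) \<in> (Restr (edges T \<union> (edges T)\<inverse>) W)\<^sup>*)"

text \<open>Subtrees are the subgraphs spanned by connected vertex sets. In a tree, connected vertex
  sets are closed under intersection, so the intersection below is the least one containing
  \<^term>\<open>L\<close>.\<close>

definition span_verts :: "'a rtree \<Rightarrow> 'a set \<Rightarrow> 'a set" where
  "span_verts T L = \<Inter> {W. L \<subseteq> W \<and> W \<subseteq> verts T \<and> connected_in T W}"

definition common_ancestors :: "'a rtree \<Rightarrow> 'a set \<Rightarrow> 'a set" where
  "common_ancestors T L = {v \<in> verts T. \<forall>l \<in> L. (v, l) \<in> (edges T)\<^sup>*}"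

definition mrca :: "'a rtree \<Rightarrow> 'a set \<Rightarrow> 'a" where
  "mrca T L =
     (THE v. v \<in> common_ancestors T L \<and> (\<forall>u \<in> common_ancestors T L. (u, v) \<in> (edges T)\<^sup>*))"

definition span_tree :: "'a rtree \<Rightarrow> 'a set \<Rightarrow> 'a rtree" where
  "span_tree T L =
     \<lparr>verts = span_verts T L, edges = Restr (edges T) (span_verts T L), top_vertex = mrca T L\<rparr>"

text \<open>All vertices of outdegree 1 are erased at once: remaining vertices become adjacent iff they
  are joined by a directed path all of whose interior vertices are erased. The root is never
  erased in the use made below, as the most recent common ancestor of a nonempty set of leaves
  does not have outdegree 1 in the tree spanned by them.\<close>

definition suppress :: "'a rtree \<Rightarrow> 'a rtree" where
  "suppress T =
     (let K = {v \<in> verts T. outdegree T v \<noteq> 1} in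
      \<lparr>verts = K,
       edges = Restr (edges T O {(x, y) \<in> edges T. outdegree T x = 1}\<^sup>*) K,
       top_vertex = top_vertex T\<rparr>)"

definition induced_tree :: "'a rtree \<Rightarrow> 'a set \<Rightarrow> 'a rtree" where
  "induced_tree T L = suppress (span_tree T L)"

definition copies :: "'a rtree \<Rightarrow> 'b rtree \<Rightarrow> nat" where
  "copies S T = card {L. L \<subseteq> leaves T \<and> L \<noteq> {} \<and> tree_iso S (induced_tree T L)}"

definition tree_density :: "'a rtree \<Rightarrow> 'b rtree \<Rightarrow> real" where
  "tree_density S T = real (copies S T) / real (card (leaves T) choose card (leaves S))"

text \<open>Every finite tree has an isomorphic copy with vertices in \<^typ>\<open>nat\<close>, so the maximum may be
  taken over trees on that type. For given \<^term>\<open>n\<close> only finitely many values occur, and there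
  is at least one if \<open>n \<ge> 1\<close>.\<close>

definition max_density :: "'a rtree \<Rightarrow> nat \<Rightarrow> real" where
  "max_density S n =
     Max {tree_density S T | T :: nat rtree. topological_tree T \<and> card (leaves T) = n}"

definition inducibility :: "'a rtree \<Rightarrow> ereal" where
  "inducibility S = limsup (\<lambda>n. ereal (max_density S n))"

definition star :: "'a rtree \<Rightarrow> bool" where
  "star T \<longleftrightarrow> topological_tree T \<and> leaves T \<subseteq> children T (top_vertex T)"

definition binary_tree :: "'a rtree \<Rightarrow> bool" where
  "binary_tree T \<longleftrightarrow> topological_tree T \<and> (\<forall>v \<in> verts T. outdegree T v \<le> 2)"

text \<open>A path in a rooted tree that starts at the root is directed away from the root.\<close>

definition root_path :: "'a rtree \<Rightarrow> 'a list \<Rightarrow> bool" where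
  "root_path T p \<longleftrightarrow>
     p \<noteq> [] \<and> hd p = top_vertex T \<and> successively (\<lambda>u v. (u, v) \<in> edges T) p"

definition binary_caterpillar :: "'a rtree \<Rightarrow> bool" where
  "binary_caterpillar T \<longleftrightarrow> binary_tree T \<and> (\<exists>p. root_path T p \<and> verts T - leaves T \<subseteq> set p)"

end

theory Submission imports Defs begin

text \<open>If \<open>S\<close> is a star or a binary caterpillar with \<open>k\<close> leaves, then every set of \<open>k\<close> leaves of a
  larger star or caterpillar, respectively, induces a copy of \<open>S\<close>, so the maximal density is 1.

  For the other direction, a topological tree with at least \<open>k ^ (k - 1)\<close> leaves has a vertex with
  \<open>k\<close> children or is deep enough to contain a long path, and so has \<open>k\<close> leaves inducing a star or a
  binary caterpillar. If \<open>S\<close> is neither, every set of \<open>m\<close> leaves, for a fixed large \<open>m\<close>, thus contains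
  a set of \<open>k\<close> leaves that does not induce \<open>S\<close>. By double counting, at least the fraction
  \<open>1 / (m choose k)\<close> of all sets of \<open>k\<close> leaves is of this kind, in every tree with at least \<open>m\<close>
  leaves.\<close>

section \<open>Induced trees in terms of the ancestor order\<close>

text \<open>The obstacle is the definition of the induced tree: an intersection of connected sets, a
  root given by definite description, and a simultaneous erasure of vertices. All of this is traded
  once, in \<open>induced_tree_eq\<close>, for the ancestor order: the vertices are the chosen
  leaves and the points where two of them part, the edges are the covering relation among these.
  From then on only \<open>splits\<close> has to be computed with. A topological tree is the induced
  tree of its own leaf set, so \<open>S\<close> and the leaf sets of a large tree are described in
  the same terms.

  The constant \<open>k ^ (k - 1)\<close>: each branching passed on the way down costs at most a
  factor \<open>k\<close>, and a caterpillar with \<open>k\<close> leaves has only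
  \<open>k - 1\<close> branchings, because its lowest entry is a single leaf. The resulting density
  bound is the same for all large trees, and therefore survives the maximum and the limsup.\<close>

text \<open>In a rooted tree this makes \<open>v\<close> the lowest common ancestor of
  \<open>x\<close> and \<open>y\<close>, and also forces \<open>x\<close> and \<open>y\<close> to be
  incomparable.\<close>

definition splits :: "'a rtree \<Rightarrow> 'a \<Rightarrow> 'a \<Rightarrow> 'a \<Rightarrow> bool" where
  "splits T v x y \<longleftrightarrow> (\<exists>c d. (v, c) \<in> edges T \<and> (v, d) \<in> edges T \<and> c \<noteq> d \<and>
     (c, x) \<in> (edges T)\<^sup>* \<and> (d, y) \<in> (edges T)\<^sup>*)"

text \<open>The vertices of outdegree other than 1 in the tree spanned by \<^term>\<open>L\<close>: these are the leaves
  and the branching points.\<close>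

definition kept :: "'a rtree \<Rightarrow> 'a set \<Rightarrow> 'a set" where
  "kept T L = L \<union> {v. \<exists>x \<in> L. \<exists>y \<in> L. splits T v x y}"

text \<open>The Hasse diagram of the ancestor order on \<open>K\<close>. Erasing the vertices
  outside \<open>K\<close> from paths leaves exactly these edges.\<close>

definition cover :: "'a rtree \<Rightarrow> 'a set \<Rightarrow> ('a \<times> 'a) set" where
  "cover T K = {(x, y). x \<in> K \<and> y \<in> K \<and> (x, y) \<in> (edges T)\<^sup>+ \<and>
     (\<forall>z \<in> K. \<not> ((x, z) \<in> (edges T)\<^sup>+ \<and> (z, y) \<in> (edges T)\<^sup>+))}"

text \<open>An explicit form of \<open>mrca T L = m\<close> that avoids definite description, for a nonempty set
  \<^term>\<open>L\<close> of leaves.\<close>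

definition apex :: "'a rtree \<Rightarrow> 'a set \<Rightarrow> 'a \<Rightarrow> bool" where
  "apex T L m \<longleftrightarrow> (\<forall>l \<in> L. (m, l) \<in> (edges T)\<^sup>*) \<and>
     (L = {m} \<or> (\<exists>x \<in> L. \<exists>y \<in> L. splits T m x y))"

lemma splits_sym: "splits T v x y \<Longrightarrow> splits T v y x"
  unfolding splits_def by blast

lemma splits_below:
  assumes "splits T v x y"
  shows "(v, x) \<in> (edges T)\<^sup>+" "(v, y) \<in> (edges T)\<^sup>+"
proof -
  obtain c d where "(v, c) \<in> edges T" "(v, d) \<in> edges T"
    "(c, x) \<in> (edges T)\<^sup>*" "(d, y) \<in> (edges T)\<^sup>*"
    using assms unfolding splits_def by blast
  then show "(v, x) \<in> (edges T)\<^sup>+" "(v, y) \<in> (edges T)\<^sup>+"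
    by (auto intro: rtrancl_into_trancl2)
qed

lemma splits_mono:
  assumes "splits T v x y" "(x, x') \<in> (edges T)\<^sup>*" "(y, y') \<in> (edges T)\<^sup>*"
  shows "splits T v x' y'"
proof -
  obtain c d where "(v, c) \<in> edges T" "(v, d) \<in> edges T" "c \<noteq> d"
    "(c, x) \<in> (edges T)\<^sup>*" "(d, y) \<in> (edges T)\<^sup>*"
    using assms(1) unfolding splits_def by blast
  with assms(2,3) show ?thesis
    unfolding splits_def by (blast intro: rtrancl_trans)
qed

section \<open>The ancestor order of a rooted tree\<close>

locale rooted =
  fixes T :: "'a rtree"
  assumes rooted_tree: "rooted_tree T"
begin

lemma finite_verts: "finite (verts T)"
  and top_in_verts: "top_vertex T \<in> verts T"
  and edges_verts: "edges T \<subseteq> verts T \<times> verts T"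
  and no_edge_to_top: "(u, top_vertex T) \<notin> edges T"
  and top_le: "v \<in> verts T \<Longrightarrow> (top_vertex T, v) \<in> (edges T)\<^sup>*"
  using rooted_tree unfolding rooted_tree_def by auto

lemma parent_unique:
  assumes "(u, v) \<in> edges T" "(u', v) \<in> edges T"
  shows "u = u'"
proof -
  have "v \<in> verts T - {top_vertex T}"
    using assms(1) edges_verts no_edge_to_top by auto
  then show ?thesis
    using rooted_tree assms unfolding rooted_tree_def by blast
qed

text \<open>A cycle through a vertex also passes through its only parent. Following parents moves
  the cycle up to the root, which has no incoming edge.\<close>

lemma acyclic: "(x, x) \<notin> (edges T)\<^sup>+"
proof
  assume cyc: "(x, x) \<in> (edges T)\<^sup>+"
  then have "x \<in> verts T"
    using edges_verts by (metis SigmaD1 subsetD tranclD)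
  from top_le[OF this] have "(x, x) \<notin> (edges T)\<^sup>+"
  proof (induction rule: rtrancl_induct)
    case base
    then show ?case by (metis no_edge_to_top tranclD2)
  next
    case (step y z)
    show ?case
    proof
      assume "(z, z) \<in> (edges T)\<^sup>+"
      then obtain p where "(z, p) \<in> (edges T)\<^sup>*" "(p, z) \<in> edges T"
        by (meson tranclD2)
      then have "(z, y) \<in> (edges T)\<^sup>*"
        using parent_unique[OF step.hyps(2)] by simp
      then show False
        using step by (meson rtrancl_into_trancl2)
    qed
  qed
  then show False using cyc by simp
qed

lemma antisym:
  assumes "(x, y) \<in> (edges T)\<^sup>*" "(y, x) \<in> (edges T)\<^sup>*"
  shows "x = y"
proof (rule ccontr)
  assume "x \<noteq> y"
  then have "(x, y) \<in> (edges T)\<^sup>+"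
    using assms(1) by (simp add: rtrancl_eq_or_trancl)
  then show False
    using assms(2) acyclic trancl_rtrancl_trancl by fast
qed

text \<open>The first form yields topmost elements of sets; the converse yields deepest elements and
  inductions that treat children before their parent.\<close>

lemma wf_edges: "wf (edges T)" and wf_converse_edges: "wf ((edges T)\<inverse>)"
proof -
  have "finite (edges T)"
    using finite_subset[OF edges_verts] finite_verts by simp
  moreover have "Transitive_Closure.acyclic (edges T)"
    using acyclic by (simp add: acyclic_def)
  ultimately show "wf (edges T)" "wf ((edges T)\<inverse>)"
    by (simp_all add: finite_acyclic_wf finite_acyclic_wf_converse)
qed

lemma above_verts: "(x, y) \<in> (edges T)\<^sup>* \<Longrightarrow> y \<in> verts T \<Longrightarrow> x \<in> verts T"
  by (induction rule: converse_rtrancl_induct) (use edges_verts in auto)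

lemma comparable:
  assumes "(x, z) \<in> (edges T)\<^sup>*" "(y, z) \<in> (edges T)\<^sup>*"
  shows "(x, y) \<in> (edges T)\<^sup>* \<or> (y, x) \<in> (edges T)\<^sup>*"
  using assms
proof (induction arbitrary: y rule: rtrancl_induct)
  case (step p z)
  show ?case
  proof (cases "y = z")
    case True
    then show ?thesis using step by (meson rtrancl.rtrancl_into_rtrancl)
  next
    case False
    then obtain q where "(y, q) \<in> (edges T)\<^sup>*" "(q, z) \<in> edges T"
      using step.prems by (metis rtranclE)
    then show ?thesis
      using step parent_unique by metis
  qed
qed auto

lemma child_unique:
  assumes "(x, c) \<in> edges T" "(x, d) \<in> edges T"
    and "(c, z) \<in> (edges T)\<^sup>*" "(d, z) \<in> (edges T)\<^sup>*"
  shows "c = d"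
proof -
  have "c = d" if ord: "(x, c) \<in> edges T" "(x, d) \<in> edges T" "(c, d) \<in> (edges T)\<^sup>*" for c d
  proof (rule ccontr)
    assume "c \<noteq> d"
    then obtain p where "(c, p) \<in> (edges T)\<^sup>*" "(p, d) \<in> edges T"
      using ord(3) by (metis rtranclE)
    then have "(c, x) \<in> (edges T)\<^sup>*"
      using parent_unique[OF ord(2)] by simp
    then show False
      using ord(1) acyclic by (meson rtrancl_into_trancl2)
  qed
  then show ?thesis
    using assms comparable[OF assms(3,4)] by metis
qed

text \<open>Only one branch at \<open>x\<close> leads to \<open>y\<close>, so whatever lies strictly
  below \<open>x\<close> on the way to \<open>y\<close> is already in the branch of
  \<open>c\<close>.\<close>

lemma child_between:
  assumes "(x, c) \<in> edges T" "(c, y) \<in> (edges T)\<^sup>*"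
    and "(x, w) \<in> (edges T)\<^sup>+" "(w, y) \<in> (edges T)\<^sup>*"
  shows "(c, w) \<in> (edges T)\<^sup>*"
proof -
  obtain d where "(x, d) \<in> edges T" "(d, w) \<in> (edges T)\<^sup>*"
    using assms(3) by (meson tranclD)
  then show ?thesis
    using child_unique assms by (metis rtrancl_trans)
qed

text \<open>Otherwise \<open>u\<close> would be strictly below \<open>v\<close>, hence below one
  child of \<open>v\<close>, and \<open>x\<close> and \<open>y\<close> would lie in the same
  branch.\<close>

lemma splits_common:
  assumes "splits T v x y" "(u, x) \<in> (edges T)\<^sup>*" "(u, y) \<in> (edges T)\<^sup>*"
  shows "(u, v) \<in> (edges T)\<^sup>*"
proof (rule ccontr)
  assume neg: "(u, v) \<notin> (edges T)\<^sup>*"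
  then have "(v, u) \<in> (edges T)\<^sup>*"
    using comparable[OF assms(2), of v] splits_below(1)[OF assms(1)]
    by (blast intro: trancl_into_rtrancl)
  then have "(v, u) \<in> (edges T)\<^sup>+"
    using neg by (metis rtranclD rtrancl.rtrancl_refl)
  moreover obtain c d where "(v, c) \<in> edges T" "(v, d) \<in> edges T" "c \<noteq> d"
    "(c, x) \<in> (edges T)\<^sup>*" "(d, y) \<in> (edges T)\<^sup>*"
    using assms(1) unfolding splits_def by blast
  ultimately show False
    using child_between child_unique assms(2,3) by metis
qed

lemma splits_unique:
  assumes "splits T v x y" "splits T u x y"
  shows "u = v"
proof (rule antisym)
  show "(u, v) \<in> (edges T)\<^sup>*"
    using splits_common[OF assms(1)] splits_below[OF assms(2)] by (simp add: trancl_into_rtrancl)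
  show "(v, u) \<in> (edges T)\<^sup>*"
    using splits_common[OF assms(2)] splits_below[OF assms(1)] by (simp add: trancl_into_rtrancl)
qed

lemma splits_irrefl: "\<not> splits T v x x"
  unfolding splits_def using child_unique by blast

lemma leaf_below:
  assumes "x \<in> leaves T" "(x, y) \<in> (edges T)\<^sup>*"
  shows "y = x"
  using assms(2)
proof (cases rule: converse_rtranclE)
  case (step z)
  then show ?thesis using assms(1) unfolding leaves_def children_def by auto
qed simp

lemma leaf_not_above: "x \<in> leaves T \<Longrightarrow> (x, y) \<notin> (edges T)\<^sup>+"
  unfolding leaves_def children_def by (auto dest: tranclD)

lemma leaves_verts: "leaves T \<subseteq> verts T"
  unfolding leaves_def by auto

lemma finite_leaves: "finite (leaves T)"
  using finite_verts leaves_verts finite_subset by blast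

lemma finite_children: "finite (children T v)"
  unfolding children_def
  by (rule finite_subset[OF _ finite_verts]) (use edges_verts in auto)

section \<open>Spanned subtrees and suppression, expressed in the ancestor order\<close>

lemma mrca_eq:
  assumes "apex T L m" "L \<subseteq> leaves T"
  shows "mrca T L = m"
proof -
  have low: "(u, m) \<in> (edges T)\<^sup>*" if "u \<in> common_ancestors T L" for u
    using that assms(1) splits_common unfolding apex_def common_ancestors_def by auto
  have "L \<noteq> {}"
    using assms(1) unfolding apex_def by auto
  then have "m \<in> common_ancestors T L"
    using assms above_verts leaves_verts unfolding apex_def common_ancestors_def by fast
  then show ?thesis
    unfolding mrca_def using low antisym by (intro the_equality) auto
qed

lemma kept_between:
  assumes "apex T L m" "x \<in> kept T L"
  shows "(m, x) \<in> (edges T)\<^sup>*" "\<exists>l \<in> L. (x, l) \<in> (edges T)\<^sup>*"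
proof -
  have mL: "(m, l) \<in> (edges T)\<^sup>*" if "l \<in> L" for l
    using assms(1) that unfolding apex_def by blast
  show "\<exists>l \<in> L. (x, l) \<in> (edges T)\<^sup>*"
  proof (cases "x \<in> L")
    case False
    then obtain y z where "y \<in> L" "splits T x y z"
      using assms(2) unfolding kept_def by blast
    then show ?thesis using splits_below(1) by (meson trancl_into_rtrancl)
  qed auto
  show "(m, x) \<in> (edges T)\<^sup>*"
  proof (cases "x \<in> L")
    case False
    then obtain y z where "y \<in> L" "z \<in> L" "splits T x y z"
      using assms(2) unfolding kept_def by blast
    then show ?thesis using splits_common mL by meson
  qed (use mL in auto)
qed

text \<open>The edge into \<open>c\<close> is the only connection between the subtree below
  \<open>c\<close> and the rest, so a connected set with members on both sides contains both ends of
  it.\<close>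

lemma connected_cut:
  assumes conn: "connected_in T W" and W: "a \<in> W" "b \<in> W"
    and cut: "(c, a) \<in> (edges T)\<^sup>*" "(c, b) \<notin> (edges T)\<^sup>*"
  shows "\<exists>p. (p, c) \<in> edges T \<and> p \<in> W \<and> c \<in> W"
proof (rule ccontr)
  assume neg: "\<not> ?thesis"
  have "(a, b) \<in> (Restr (edges T \<union> (edges T)\<inverse>) W)\<^sup>*"
    using conn W unfolding connected_in_def by blast
  then have "(c, b) \<in> (edges T)\<^sup>*"
  proof (induction rule: rtrancl_induct)
    case (step y z)
    show ?case
    proof (cases "(y, z) \<in> edges T")
      case False
      then have zy: "(z, y) \<in> edges T" "z \<in> W" "y \<in> W"
        using step.hyps(2) by auto
      \<comment> \<open>Going up from \<open>c\<close> itself would use the edge excluded by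
        \<open>neg\<close>; hence the parent \<open>z\<close> of \<open>y\<close> is still below
        \<open>c\<close>.\<close>
      then have "y \<noteq> c" using neg by blast
      then obtain q where "(c, q) \<in> (edges T)\<^sup>*" "(q, y) \<in> edges T"
        using step.IH by (metis rtranclE)
      then show ?thesis using parent_unique zy(1) by metis
    qed (use step in auto)
  qed (use cut in auto)
  then show False using cut by simp
qed

text \<open>The set on the right is connected through \<open>m\<close>. Conversely, a connected set
  containing \<open>L\<close> cannot miss one of its vertices: \<open>m\<close> is found by cutting
  above the child of \<open>m\<close> that leads to one of two leaves parting at \<open>m\<close>,
  and any other \<open>x\<close> by cutting above \<open>x\<close>, since those two leaves are not
  both below \<open>x\<close>.\<close>

lemma span_verts_eq:
  assumes L: "L \<subseteq> leaves T" and m: "apex T L m"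
  shows "span_verts T L = {x. (m, x) \<in> (edges T)\<^sup>* \<and> (\<exists>l \<in> L. (x, l) \<in> (edges T)\<^sup>*)}"
    (is "_ = ?P")
proof
  have mL: "(m, l) \<in> (edges T)\<^sup>*" if "l \<in> L" for l
    using m that unfolding apex_def by blast
  have reach: "(m, x) \<in> (Restr (edges T) ?P)\<^sup>*" if x: "x \<in> ?P" for x
  proof -
    obtain l where l: "l \<in> L" "(x, l) \<in> (edges T)\<^sup>*" and "(m, x) \<in> (edges T)\<^sup>*"
      using x by auto
    from this(3) show ?thesis
      using l(2)
    proof (induction rule: rtrancl_induct)
      case (step y z)
      then have "(y, z) \<in> Restr (edges T) ?P"
        using l(1) by (auto intro: rtrancl_trans)
      then show ?case using step
        by (meson converse_rtrancl_into_rtrancl rtrancl.rtrancl_into_rtrancl)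
    qed simp
  qed
  have sub: "(Restr (edges T) ?P)\<^sup>* \<subseteq> (Restr (edges T \<union> (edges T)\<inverse>) ?P)\<^sup>*"
    by (rule rtrancl_mono) auto
  have "sym (Restr (edges T \<union> (edges T)\<inverse>) ?P)"
    by (auto simp: sym_def)
  then have sym: "sym ((Restr (edges T \<union> (edges T)\<inverse>) ?P)\<^sup>*)"
    by (rule sym_rtrancl)
  have "connected_in T ?P"
    unfolding connected_in_def
  proof (intro ballI)
    fix x y assume "x \<in> ?P" "y \<in> ?P"
    then have "(m, x) \<in> (Restr (edges T \<union> (edges T)\<inverse>) ?P)\<^sup>*"
      "(m, y) \<in> (Restr (edges T \<union> (edges T)\<inverse>) ?P)\<^sup>*"
      using reach sub by blast+
    then show "(x, y) \<in> (Restr (edges T \<union> (edges T)\<inverse>) ?P)\<^sup>*"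
      using sym by (meson rtrancl_trans symD)
  qed
  moreover have "L \<subseteq> ?P" using mL by auto
  moreover have "?P \<subseteq> verts T"
    using L leaves_verts above_verts by auto
  ultimately show "span_verts T L \<subseteq> ?P"
    unfolding span_verts_def by blast
  show "?P \<subseteq> span_verts T L"
    unfolding span_verts_def
  proof (intro subsetI InterI)
    fix x W assume x: "x \<in> ?P"
      and "W \<in> {W. L \<subseteq> W \<and> W \<subseteq> verts T \<and> connected_in T W}"
    then have W: "L \<subseteq> W" "connected_in T W" by auto
    obtain l where l: "l \<in> L" "(x, l) \<in> (edges T)\<^sup>*" and mx: "(m, x) \<in> (edges T)\<^sup>*"
      using x by auto
    show "x \<in> W"
    proof (cases "L = {m}")
      case True
      then show ?thesis using l mx W antisym by auto
    next
      case False
      then obtain y z where yz: "y \<in> L" "z \<in> L" "splits T m y z"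
        using m unfolding apex_def by blast
      show ?thesis
      proof (cases "x = m")
        case True
        obtain c d where cd: "(m, c) \<in> edges T" "(m, d) \<in> edges T" "c \<noteq> d"
          "(c, y) \<in> (edges T)\<^sup>*" "(d, z) \<in> (edges T)\<^sup>*"
          using yz(3) unfolding splits_def by blast
        then have "(c, z) \<notin> (edges T)\<^sup>*"
          using child_unique by blast
        then show ?thesis
          using connected_cut[OF W(2) _ _ cd(4)] yz W(1) cd(1) parent_unique True by blast
      next
        case False
        then have "(x, y) \<notin> (edges T)\<^sup>* \<or> (x, z) \<notin> (edges T)\<^sup>*"
          using splits_common[OF yz(3)] antisym mx by blast
        then show ?thesis
          using connected_cut[OF W(2) _ _ l(2)] W(1) l(1) yz by blast
      qed
    qed
  qed
qed

text \<open>The children of \<open>x\<close> that survive in the span are those with a member of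
  \<open>L\<close> below. None means that \<open>x\<close> is in \<open>L\<close>, two or more mean
  that two members of \<open>L\<close> part at \<open>x\<close>.\<close>

lemma outdegree_span:
  assumes L: "L \<subseteq> leaves T" and m: "apex T L m" and x: "x \<in> span_verts T L"
  shows "outdegree (span_tree T L) x \<noteq> 1 \<longleftrightarrow> x \<in> kept T L"
proof -
  let ?C = "children (span_tree T L) x"
  note P = span_verts_eq[OF L m]
  have C: "?C = {y. (x, y) \<in> edges T \<and> (\<exists>l \<in> L. (y, l) \<in> (edges T)\<^sup>*)}"
  proof -
    have "y \<in> span_verts T L" if "(x, y) \<in> edges T" "l \<in> L" "(y, l) \<in> (edges T)\<^sup>*" for y l
      using x that unfolding P by (auto intro: rtrancl_into_rtrancl)
    then show ?thesis
      using x unfolding children_def span_tree_def by (auto simp: P)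
  qed
  show ?thesis
  proof
    assume "x \<in> kept T L"
    then consider "x \<in> L" | y z where "y \<in> L" "z \<in> L" "splits T x y z"
      unfolding kept_def by blast
    then show "card ?C \<noteq> 1"
    proof cases
      case 1
      then have "?C = {}"
        unfolding C using L by (auto simp: leaves_def children_def[of T])
      then show ?thesis by simp
    next
      case 2
      then obtain c d where "c \<in> ?C" "d \<in> ?C" "c \<noteq> d"
        unfolding C splits_def by blast
      then show ?thesis by (auto simp: card_1_singleton_iff)
    qed
  next
    assume card: "card ?C \<noteq> 1"
    show "x \<in> kept T L"
    proof (rule ccontr)
      assume nk: "x \<notin> kept T L"
      obtain l where l: "l \<in> L" "(x, l) \<in> (edges T)\<^sup>*"
        using x unfolding P by blast
      then have "x \<noteq> l" using nk unfolding kept_def by blast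
      then obtain c where c: "(x, c) \<in> edges T" "(c, l) \<in> (edges T)\<^sup>*"
        using l(2) by (metis converse_rtranclE)
      \<comment> \<open>A second surviving child would lead to another member of \<open>L\<close>,
        and \<open>x\<close> would be kept as a branching point.\<close>
      have "?C = {c}"
        using c l nk unfolding C kept_def splits_def by blast
      then show False using card by simp
    qed
  qed
qed

lemma kept_verts: "L \<subseteq> leaves T \<Longrightarrow> kept T L \<subseteq> verts T"
  using leaves_verts edges_verts unfolding kept_def splits_def by blast

text \<open>An edge after suppression is one edge followed by an \<open>R\<close>-path.
  \<open>R\<close> consists of the edges of the span that start at an erased vertex, so such a path
  meets no kept vertex before its end; this is the covering condition.\<close>

lemma induced_tree_eq:
  assumes L: "L \<subseteq> leaves T" and m: "apex T L m"
  shows "induced_tree T L =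
    \<lparr>verts = kept T L, edges = cover T (kept T L), top_vertex = m\<rparr>"
proof -
  define P where "P = span_verts T L"
  define K where "K = kept T L"
  define R where "R = {(x, y) \<in> Restr (edges T) P. x \<notin> K}"
  note Peq = span_verts_eq[OF L m, folded P_def]
  note out = outdegree_span[OF L m, folded P_def K_def]
  have KP: "K \<subseteq> P"
    using kept_between[OF m] unfolding K_def Peq by auto
  have K: "{v \<in> P. outdegree (span_tree T L) v \<noteq> 1} = K"
    using out KP by blast
  have R: "{(x, y) \<in> edges (span_tree T L). outdegree (span_tree T L) x = 1} = R"
    using out unfolding R_def by (auto simp: span_tree_def P_def)
  have conv: "z \<in> P" if "(x, z) \<in> (edges T)\<^sup>*" "(z, y) \<in> (edges T)\<^sup>*" "x \<in> P" "y \<in> P" for x y z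
    using that unfolding Peq by (auto intro: rtrancl_trans)
  \<comment> \<open>The end \<open>y\<close> is exempt from being erased, and \<open>z = y\<close>
    is allowed, because the first edge of the suppressed path is not part of
    \<open>R\<close>.\<close>
  have sound: "(z, y) \<in> (edges T)\<^sup>* \<and>
      (\<forall>w. (z, w) \<in> (edges T)\<^sup>* \<longrightarrow> (w, y) \<in> (edges T)\<^sup>* \<longrightarrow> w = y \<or> w \<notin> K)"
    if "(z, y) \<in> R\<^sup>*" for z y
    using that
  proof (induction rule: converse_rtrancl_induct)
    case base
    then show ?case using antisym by auto
  next
    case (step z z')
    have e: "(z, z') \<in> edges T" "z \<notin> K"
      using step.hyps(1) unfolding R_def by auto
    have "w = y \<or> w \<notin> K" if w: "(z, w) \<in> (edges T)\<^sup>*" "(w, y) \<in> (edges T)\<^sup>*" for w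
    proof (cases "w = z")
      case False
      then have "(z, w) \<in> (edges T)\<^sup>+"
        using w(1) by (simp add: rtrancl_eq_or_trancl)
      then have "(z', w) \<in> (edges T)\<^sup>*"
        using child_between e(1) step.IH w(2) by blast
      then show ?thesis using step.IH w(2) by blast
    qed (use e in simp)
    then show ?case
      using step.IH e(1) by (auto intro: converse_rtrancl_into_rtrancl)
  qed
  have complete: "(z, y) \<in> R\<^sup>*"
    if "(z, y) \<in> (edges T)\<^sup>*" "z \<in> P" "y \<in> P"
      "\<And>w. (z, w) \<in> (edges T)\<^sup>* \<Longrightarrow> (w, y) \<in> (edges T)\<^sup>+ \<Longrightarrow> w \<notin> K" for z y
    using that
  proof (induction rule: converse_rtrancl_induct)
    case (step z z')
    have "z' \<in> P"
      using conv[of z z' y] step.hyps step.prems by auto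
    moreover have "z \<notin> K"
      using step.prems(3)[of z] step.hyps by (auto intro: rtrancl_into_trancl2)
    ultimately have "(z, z') \<in> R"
      using step unfolding R_def by auto
    moreover have "(z', y) \<in> R\<^sup>*"
      using step.IH[OF \<open>z' \<in> P\<close> step.prems(2)] step.prems(3) step.hyps(1)
      by (meson converse_rtrancl_into_rtrancl)
    ultimately show ?case by (rule converse_rtrancl_into_rtrancl)
  qed simp
  have "Restr (Restr (edges T) P O R\<^sup>*) K = cover T K"
  proof (intro equalityI subsetI; clarify)
    fix x y z assume xy: "x \<in> K" "y \<in> K" and xz: "(x, z) \<in> edges T" and zy: "(z, y) \<in> R\<^sup>*"
    have "\<not> ((x, w) \<in> (edges T)\<^sup>+ \<and> (w, y) \<in> (edges T)\<^sup>+)" if "w \<in> K" for w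
    proof
      assume w: "(x, w) \<in> (edges T)\<^sup>+ \<and> (w, y) \<in> (edges T)\<^sup>+"
      then have "(z, w) \<in> (edges T)\<^sup>*"
        using child_between[OF xz] sound[OF zy] by (blast intro: trancl_into_rtrancl)
      then have "w = y"
        using sound[OF zy] w that by (blast intro: trancl_into_rtrancl)
      then show False using w acyclic by blast
    qed
    then show "(x, y) \<in> cover T K"
      using xy xz sound[OF zy] unfolding cover_def by (auto intro: rtrancl_into_trancl2)
  next
    fix x y assume "(x, y) \<in> cover T K"
    then have xy: "x \<in> K" "y \<in> K" "(x, y) \<in> (edges T)\<^sup>+"
      and no: "\<And>w. w \<in> K \<Longrightarrow> \<not> ((x, w) \<in> (edges T)\<^sup>+ \<and> (w, y) \<in> (edges T)\<^sup>+)"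
      unfolding cover_def by auto
    obtain z where z: "(x, z) \<in> edges T" "(z, y) \<in> (edges T)\<^sup>*"
      using xy(3) by (meson tranclD)
    have "z \<in> P"
      using conv[of x z y] z xy KP by auto
    moreover have "(z, y) \<in> R\<^sup>*"
      using complete[OF z(2) \<open>z \<in> P\<close>] xy KP no z(1) by (meson rtrancl_into_trancl2 subsetD)
    ultimately show "(x, y) \<in> Restr (Restr (edges T) P O R\<^sup>*) K"
      using z xy KP by auto
  qed
  then show ?thesis
    using K R mrca_eq[OF m L]
    unfolding induced_tree_def suppress_def Let_def by (simp add: span_tree_def P_def K_def)
qed

text \<open>A deepest common ancestor outside \<open>L\<close> must branch: the child leading to one
  member of \<open>L\<close> is no common ancestor, so it misses another member.\<close>

lemma apex_exists:
  assumes L: "L \<subseteq> leaves T" "L \<noteq> {}"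
  shows "\<exists>m \<in> verts T. apex T L m"
proof -
  let ?A = "{v \<in> verts T. \<forall>l \<in> L. (v, l) \<in> (edges T)\<^sup>*}"
  have "top_vertex T \<in> ?A"
    using L leaves_verts top_in_verts top_le by auto
  then obtain m where m: "m \<in> ?A" and max: "\<And>v. (m, v) \<in> edges T \<Longrightarrow> v \<notin> ?A"
    by (rule wfE_min[OF wf_converse_edges]) auto
  obtain l where l: "l \<in> L" using L by blast
  have "apex T L m"
  proof (cases "m = l")
    case True
    then have "L = {m}"
      using m l L leaf_below by blast
    then show ?thesis unfolding apex_def by auto
  next
    case False
    then obtain c where c: "(m, c) \<in> edges T" "(c, l) \<in> (edges T)\<^sup>*"
      using m l by (metis (no_types, lifting) converse_rtranclE mem_Collect_eq)
    have "c \<in> verts T"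
      using c(1) edges_verts by auto
    then obtain l' where l': "l' \<in> L" "(c, l') \<notin> (edges T)\<^sup>*"
      using max[OF c(1)] by blast
    have "m \<noteq> l'"
      using L l' c(1) unfolding leaves_def children_def by auto
    then obtain d where "(m, d) \<in> edges T" "(d, l') \<in> (edges T)\<^sup>*"
      using m l' by (metis (no_types, lifting) converse_rtranclE mem_Collect_eq)
    then have "splits T m l l'"
      using c l' unfolding splits_def by blast
    then show ?thesis
      using m l l' unfolding apex_def by blast
  qed
  then show ?thesis using m by blast
qed

text \<open>A kept branching point has kept vertices strictly below it, and a topmost one of these
  is its child in the induced tree. This fixes the number of leaves of a set that induces
  \<open>S\<close>.\<close>

lemma leaves_induced_tree:
  assumes L: "L \<subseteq> leaves T" "L \<noteq> {}"
  shows "leaves (induced_tree T L) = L"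
proof -
  obtain m where "apex T L m"
    using apex_exists[OF L] by blast
  note eq = induced_tree_eq[OF L(1) this]
  have "x \<in> L" if x: "x \<in> leaves (induced_tree T L)" for x
  proof (rule ccontr)
    assume "x \<notin> L"
    then obtain y where y: "y \<in> L" "(x, y) \<in> (edges T)\<^sup>+"
      using x splits_below(1) unfolding eq leaves_def kept_def by fastforce
    let ?B = "{z \<in> kept T L. (x, z) \<in> (edges T)\<^sup>+}"
    have "y \<in> ?B"
      using y unfolding kept_def by auto
    then obtain z where z: "z \<in> ?B" and "\<And>w. (w, z) \<in> (edges T)\<^sup>+ \<Longrightarrow> w \<notin> ?B"
      by (rule wfE_min[OF wf_trancl[OF wf_edges]]) blast
    then have "(x, z) \<in> edges (induced_tree T L)"
      using x unfolding eq cover_def leaves_def by auto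
    then show False
      using x unfolding leaves_def children_def by auto
  qed
  moreover have "x \<in> leaves (induced_tree T L)" if "x \<in> L" for x
    using that L(1) leaf_not_above unfolding eq leaves_def children_def cover_def kept_def by auto
  ultimately show ?thesis by blast
qed

end

section \<open>Leaf sets inducing stars and binary caterpillars\<close>

text \<open>Splitting pairwise at the same vertex puts the leaves below different children of
  \<open>v\<close>. With a single leaf the condition would be vacuous and \<open>v\<close>
  arbitrary, hence the bound on the cardinality.\<close>

definition star_like :: "'a rtree \<Rightarrow> 'a \<Rightarrow> 'a set \<Rightarrow> bool" where
  "star_like T v L \<longleftrightarrow> L \<subseteq> leaves T \<and> card L \<ge> 2 \<and>
     (\<forall>l \<in> L. \<forall>l' \<in> L. l \<noteq> l' \<longrightarrow> splits T v l l')"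

text \<open>Leaves listed from the top down, each leaving the path at a branching point; the last two
  leaves are interchangeable.\<close>

inductive comb :: "'a rtree \<Rightarrow> 'a \<Rightarrow> 'a list \<Rightarrow> bool" for T where
  single: "l \<in> leaves T \<Longrightarrow> comb T l [l]"
| cons: "splits T v l w \<Longrightarrow> l \<in> leaves T \<Longrightarrow> comb T w ls \<Longrightarrow> comb T v (l # ls)"

text \<open>The bare graph of a caterpillar with \<open>n\<close> leaves, detached from any
  surrounding tree, so that caterpillars on different vertex types can be compared.\<close>

inductive comb_shape :: "'a set \<Rightarrow> ('a \<times> 'a) set \<Rightarrow> 'a \<Rightarrow> nat \<Rightarrow> bool" where
  leaf: "comb_shape {r} {} r (Suc 0)"
| node: "comb_shape V E w n \<Longrightarrow> l \<notin> V \<Longrightarrow> r \<notin> V \<Longrightarrow> l \<noteq> r \<Longrightarrow>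
    comb_shape (insert r (insert l V)) (insert (r, l) (insert (r, w) E)) r (Suc n)"

context rooted
begin

text \<open>Two leaves part at only one vertex, so \<open>v\<close> is the only branching point that
  is kept.\<close>

lemma star_like_induced:
  assumes "star_like T v L"
  shows "induced_tree T L = \<lparr>verts = insert v L, edges = {v} \<times> L, top_vertex = v\<rparr>" "v \<notin> L"
proof -
  have L: "L \<subseteq> leaves T" and card: "card L \<ge> 2"
    and sp: "\<And>l l'. l \<in> L \<Longrightarrow> l' \<in> L \<Longrightarrow> l \<noteq> l' \<Longrightarrow> splits T v l l'"
    using assms unfolding star_like_def by auto
  have other: "\<exists>l' \<in> L. l' \<noteq> l" for l
  proof (rule ccontr)
    assume "\<not> ?thesis"
    then have "L \<subseteq> {l}" by blast
    then have "card L \<le> 1" using card_mono[of "{l}" L] by simp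
    then show False using card by simp
  qed
  have below: "(v, l) \<in> (edges T)\<^sup>+" if "l \<in> L" for l
    using other[of l] sp[OF that] splits_below(1) by metis
  show vL: "v \<notin> L" using below acyclic by blast
  obtain a b where ab: "a \<in> L" "b \<in> L" "splits T v a b"
    using other sp by metis
  have "apex T L v"
    using ab below unfolding apex_def by (blast intro: trancl_into_rtrancl)
  note eq = induced_tree_eq[OF L this]
  have kept: "kept T L = insert v L"
  proof -
    have "x = v" if "y \<in> L" "z \<in> L" "splits T x y z" for x y z
      using that sp[of y z] splits_unique splits_irrefl by metis
    then show ?thesis
      using ab unfolding kept_def by blast
  qed
  have "cover T (insert v L) = {v} \<times> L"
    unfolding cover_def using L leaf_not_above below acyclic by auto
  then show "induced_tree T L = \<lparr>verts = insert v L, edges = {v} \<times> L, top_vertex = v\<rparr>"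
    unfolding eq kept by simp
qed

lemma comb_apex:
  assumes "comb T v ls"
  shows "set ls \<subseteq> leaves T" "ls \<noteq> []" "apex T (set ls) v"
proof -
  have "set ls \<subseteq> leaves T \<and> ls \<noteq> [] \<and> apex T (set ls) v"
    using assms
  proof induction
    case (single l)
    then show ?case unfolding apex_def by auto
  next
    case (cons v l w ls)
    then obtain x where x: "x \<in> set ls" "(w, x) \<in> (edges T)\<^sup>*"
      unfolding apex_def by (metis hd_in_set)
    have "splits T v l x"
      using splits_mono[OF cons.hyps(1)] x(2) by blast
    moreover have "(v, y) \<in> (edges T)\<^sup>*" if "y \<in> set (l # ls)" for y
      using that cons.IH splits_below[OF cons.hyps(1)] unfolding apex_def
      by (auto intro: trancl_into_rtrancl rtrancl_trans)
    ultimately show ?case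
      using cons x unfolding apex_def by auto
  qed
  then show "set ls \<subseteq> leaves T" "ls \<noteq> []" "apex T (set ls) v" by auto
qed

lemma comb_distinct: "comb T v ls \<Longrightarrow> distinct ls"
proof (induction rule: comb.induct)
  case (cons v l w ls)
  have "splits T v l y" if "y \<in> set ls" for y
    using splits_mono[OF cons.hyps(1)] comb_apex(3)[OF cons.hyps(3)] that
    unfolding apex_def by blast
  then show ?case using splits_irrefl cons by auto
qed simp

text \<open>The new leaf parts from every earlier one at \<open>v\<close>, since these are all below
  \<open>w\<close>; uniqueness of the splitting vertex excludes further branching points.\<close>

lemma kept_comb_Cons:
  assumes "splits T v l w" "comb T w ls"
  shows "kept T (set (l # ls)) = insert v (insert l (kept T (set ls)))"
proof -
  have low: "(w, y) \<in> (edges T)\<^sup>*" if "y \<in> set ls" for y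
    using comb_apex(3)[OF assms(2)] that unfolding apex_def by blast
  then have sp: "splits T v l y" if "y \<in> set ls" for y
    using splits_mono[OF assms(1)] that by blast
  have old: "x = v \<or> x \<in> kept T (set ls)"
    if yz: "y \<in> set (l # ls)" "z \<in> set (l # ls)" "splits T x y z" for x y z
  proof (cases "y \<in> set ls \<and> z \<in> set ls")
    case True
    then show ?thesis using yz(3) unfolding kept_def by blast
  next
    case False
    moreover have "y \<noteq> z" using yz(3) splits_irrefl by blast
    ultimately consider "y = l" "z \<in> set ls" | "z = l" "y \<in> set ls"
      using yz(1,2) by auto
    then have "x = v"
      using sp yz(3) splits_unique splits_sym by metis
    then show ?thesis by simp
  qed
  have "kept T (set (l # ls)) \<subseteq> insert v (insert l (kept T (set ls)))"
  proof (intro subsetI)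
    fix x assume "x \<in> kept T (set (l # ls))"
    then consider "x \<in> set (l # ls)"
      | y z where "y \<in> set (l # ls)" "z \<in> set (l # ls)" "splits T x y z"
      unfolding kept_def by blast
    then show "x \<in> insert v (insert l (kept T (set ls)))"
      by cases (use old in \<open>auto simp: kept_def\<close>)
  qed
  moreover obtain y where "y \<in> set ls"
    using comb_apex(2)[OF assms(2)] by (metis hd_in_set)
  then have "insert v (insert l (kept T (set ls))) \<subseteq> kept T (set (l # ls))"
    using sp unfolding kept_def by auto
  ultimately show ?thesis by blast
qed

text \<open>As \<open>w\<close> is the top of \<open>K\<close>, it separates \<open>v\<close> from
  the rest of \<open>K\<close>, and \<open>l\<close> is incomparable to all of \<open>K\<close>.
  Thus \<open>v\<close> covers \<open>l\<close> and \<open>w\<close> only.\<close>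

lemma cover_insert_apex:
  assumes sp: "splits T v l w" and l: "l \<in> leaves T" and w: "w \<in> K"
    and low: "\<And>x. x \<in> K \<Longrightarrow> (w, x) \<in> (edges T)\<^sup>*"
  shows "cover T (insert v (insert l K)) = insert (v, l) (insert (v, w) (cover T K))"
    "l \<notin> K" "v \<notin> K" "l \<noteq> v"
proof -
  note below = splits_below[OF sp]
  have lw: "(w, l) \<notin> (edges T)\<^sup>*"
    using splits_mono[OF sp rtrancl.rtrancl_refl, of l] splits_irrefl by blast
  show lK: "l \<notin> K" using lw low by blast
  show vK: "v \<notin> K" using below(2) low acyclic by (meson trancl_rtrancl_trancl)
  show lv: "l \<noteq> v" using below(1) acyclic by blast
  have vx: "(v, x) \<in> (edges T)\<^sup>+" if "x \<in> K" for x
    using below(2) low[OF that] by simp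
  have xl: "(x, l) \<notin> (edges T)\<^sup>+" if "x \<in> K" for x
    using lw low[OF that] by (meson rtrancl_trans trancl_into_rtrancl)
  have xv: "(x, v) \<notin> (edges T)\<^sup>+" if "x \<in> K" for x
    using vx[OF that] acyclic by (meson trancl_trans)
  have wx: "x = w \<or> (w, x) \<in> (edges T)\<^sup>+" if "x \<in> K" for x
    using low[OF that] by (auto simp: rtrancl_eq_or_trancl)
  have xw: "(x, w) \<notin> (edges T)\<^sup>+" if "x \<in> K" for x
    using low[OF that] acyclic by (meson rtrancl_trancl_trancl)
  let ?K = "insert v (insert l K)"
  have "(v, y) \<in> cover T ?K \<longleftrightarrow> y = l \<or> y = w" for y
  proof
    assume vy: "(v, y) \<in> cover T ?K"
    then have "y \<in> K \<or> y = l" "(w, y) \<notin> (edges T)\<^sup>+"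
      using acyclic below w unfolding cover_def by auto
    then show "y = l \<or> y = w" using wx by blast
  next
    assume "y = l \<or> y = w"
    then show "(v, y) \<in> cover T ?K"
      using below w acyclic xl xw leaf_not_above[OF l] unfolding cover_def by auto
  qed
  moreover have "(l, y) \<notin> cover T ?K" for y
    using leaf_not_above[OF l] unfolding cover_def by auto
  moreover have "(x, y) \<in> cover T ?K \<longleftrightarrow> (x, y) \<in> cover T K" if "x \<in> K" for x y
    using that xl xv leaf_not_above[OF l] unfolding cover_def by auto
  moreover have "cover T ?K \<subseteq> ?K \<times> ?K" "cover T K \<subseteq> K \<times> K"
    unfolding cover_def by auto
  ultimately show "cover T ?K = insert (v, l) (insert (v, w) (cover T K))"
    by (intro set_eqI) (auto simp: lK vK lv)
qed

lemma comb_comb_shape: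
  "comb T v ls \<Longrightarrow>
    comb_shape (kept T (set ls)) (cover T (kept T (set ls))) v (length ls)"
proof (induction rule: comb.induct)
  case (single l)
  have "kept T {l} = {l}"
    using splits_irrefl unfolding kept_def by auto
  moreover have "cover T {l} = {}"
    using acyclic unfolding cover_def by auto
  ultimately show ?case
    using comb_shape.leaf by simp
next
  case (cons v l w ls)
  let ?K = "kept T (set ls)"
  note a = comb_apex[OF cons.hyps(3)]
  have "w \<in> ?K"
    using a(3) unfolding apex_def kept_def by blast
  note c = cover_insert_apex[OF cons.hyps(1,2) this kept_between(1)[OF a(3)]]
  show ?case
    using comb_shape.node[OF cons.IH c(2-4)]
    using kept_comb_Cons[OF cons.hyps(1,3)] c(1) by simp
qed

lemma comb_induced:
  assumes "comb T v ls"
  shows "\<exists>V E. induced_tree T (set ls) = \<lparr>verts = V, edges = E, top_vertex = v\<rparr> \<and>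
    comb_shape V E v (length ls)"
  using induced_tree_eq comb_apex[OF assms] comb_comb_shape[OF assms] by blast

end

section \<open>Caterpillar shapes and their transport along isomorphisms\<close>

lemma comb_shape_root: "comb_shape V E r n \<Longrightarrow> r \<in> V \<and> E \<subseteq> V \<times> V \<and> finite V \<and> n \<noteq> 0"
  by (induction rule: comb_shape.induct) auto

text \<open>Equal \<open>n\<close> forces the same rule on both sides, since no shape has
  \<open>n = 0\<close>. The isomorphism of the smaller shapes is then extended to the new root and
  the new leaf.\<close>

lemma comb_shape_iso:
  assumes "comb_shape V E r n" "comb_shape V' E' r' n"
  shows "\<exists>f. bij_betw f V V' \<and> f r = r' \<and>
    (\<forall>u \<in> V. \<forall>v \<in> V. (u, v) \<in> E \<longleftrightarrow> (f u, f v) \<in> E')"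
  using assms
proof (induction arbitrary: V' E' r' rule: comb_shape.induct)
  case (leaf r)
  then have "V' = {r'} \<and> E' = {}"
    by (cases rule: comb_shape.cases) (auto dest: comb_shape_root)
  then show ?case by (intro exI[of _ "\<lambda>_. r'"]) auto
next
  case (node V E w n l r)
  from node.prems node.hyps(1) obtain W F w' l' where
    V': "V' = insert r' (insert l' W)" "E' = insert (r', l') (insert (r', w') F)"
    and sh: "comb_shape W F w' n" and new: "l' \<notin> W" "r' \<notin> W" "l' \<noteq> r'"
    by (cases rule: comb_shape.cases) (auto dest: comb_shape_root)
  obtain f where f: "bij_betw f V W" "f w = w'"
    "\<And>u v. u \<in> V \<Longrightarrow> v \<in> V \<Longrightarrow> (u, v) \<in> E \<longleftrightarrow> (f u, f v) \<in> F"
    using node.IH[OF sh] by blast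
  define g where "g = f(l := l', r := r')"
  have gV: "g x = f x" if "x \<in> V" for x
    using that node.hyps unfolding g_def by auto
  have gl: "g l = l'" and gr: "g r = r'"
    using node.hyps unfolding g_def by auto
  have fW: "f x \<in> W" "f x \<noteq> l'" "f x \<noteq> r'" if "x \<in> V" for x
    using bij_betwE[OF f(1)] that new by auto
  have "bij_betw g V W"
    using f(1) gV by (simp cong: bij_betw_cong)
  then have "bij_betw g (insert l V) (insert l' W)"
    using node.hyps new gl by (metis notIn_Un_bij_betw Un_insert_right sup_bot.right_neutral)
  then have bij: "bij_betw g (insert r (insert l V)) (insert r' (insert l' W))"
    using notIn_Un_bij_betw[of r "insert l V" g "insert l' W"] node.hyps new gr by auto
  note E = comb_shape_root[OF node.hyps(1)] and F = comb_shape_root[OF sh]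
  have wV: "f x = w' \<longleftrightarrow> x = w" if "x \<in> V" for x
    using f(1,2) E that by (metis bij_betw_inv_into_left)
  have "(u, v) \<in> insert (r, l) (insert (r, w) E) \<longleftrightarrow>
      (g u, g v) \<in> insert (r', l') (insert (r', w') F)"
    if "u \<in> insert r (insert l V)" "v \<in> insert r (insert l V)" for u v
    using that
  proof (elim insertE)
    show ?thesis if "u \<in> V" "v \<in> V"
      using that f(3) node.hyps new gV fW by auto
  next
    show ?thesis if "u = r" "v \<in> V"
      using that wV gr gV node.hyps new fW E F by auto
  qed (use gl gr gV fW node.hyps new E F in auto)
  then show ?case
    using bij gr unfolding V' by blast
qed

text \<open>The path runs through the roots of the nested shapes, down to and including the lowest
  vertex; no other vertex has outgoing edges.\<close>

lemma comb_shape_caterpillar: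
  assumes "comb_shape V E r n"
  shows "\<forall>v. card {w. (v, w) \<in> E} \<le> 2"
    "\<exists>p. p \<noteq> [] \<and> hd p = r \<and> successively (\<lambda>u v. (u, v) \<in> E) p \<and> set p \<subseteq> V \<and> Domain E \<subseteq> set p"
proof -
  show "\<forall>v. card {w. (v, w) \<in> E} \<le> 2"
    using assms
  proof induction
    case (node V E w n l r)
    have "{x. (r, x) \<in> insert (r, l) (insert (r, w) E)} = {l, w}"
      using comb_shape_root[OF node.hyps(1)] node.hyps by auto
    moreover have "{x. (v, x) \<in> insert (r, l) (insert (r, w) E)} = {w. (v, w) \<in> E}" if "v \<noteq> r" for v
      using that by auto
    moreover have "card {l, w} \<le> 2"
      by (cases "l = w") auto
    ultimately show ?case
      using node.IH by metis
  qed simp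
  show "\<exists>p. p \<noteq> [] \<and> hd p = r \<and> successively (\<lambda>u v. (u, v) \<in> E) p \<and> set p \<subseteq> V \<and> Domain E \<subseteq> set p"
    using assms
  proof induction
    case (leaf r)
    then show ?case by (intro exI[of _ "[r]"]) auto
  next
    case (node V E w n l r)
    then obtain p where p: "p \<noteq> []" "hd p = w" "successively (\<lambda>u v. (u, v) \<in> E) p" "set p \<subseteq> V"
      "Domain E \<subseteq> set p" by blast
    have "successively (\<lambda>u v. (u, v) \<in> insert (r, l) (insert (r, w) E)) (r # p)"
      using p(1,2) successively_mono[OF p(3)] by (auto simp: successively_Cons)
    then show ?case
      using p by (intro exI[of _ "r # p"]) auto
  qed
qed

lemma comb_shape_binary_caterpillar:
  assumes S: "topological_tree S" and iso: "tree_iso S U"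
    and U: "comb_shape (verts U) (edges U) (top_vertex U) n"
  shows "binary_caterpillar S"
proof -
  interpret rooted S
    using S unfolding topological_tree_def by unfold_locales auto
  obtain f where f: "bij_betw f (verts S) (verts U)" "f (top_vertex S) = top_vertex U"
    "\<And>u v. u \<in> verts S \<Longrightarrow> v \<in> verts S \<Longrightarrow> (u, v) \<in> edges S \<longleftrightarrow> (f u, f v) \<in> edges U"
    using iso unfolding tree_iso_def by blast
  define g where "g = inv_into (verts S) f"
  have fg: "f (g x) = x" "g x \<in> verts S" if "x \<in> verts U" for x
    using that f(1) unfolding g_def
    by (auto simp: bij_betw_inv_into_right bij_betw_imp_surj_on inv_into_into)
  have gf: "g (f x) = x" if "x \<in> verts S" for x
    using that f(1) unfolding g_def by (simp add: bij_betw_inv_into_left)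
  have fin: "finite {w. (v, w) \<in> edges U}" for v
    by (rule finite_subset[of _ "verts U"]) (use comb_shape_root[OF U] in auto)
  have "outdegree S v \<le> 2" if "v \<in> verts S" for v
  proof -
    have "f ` children S v \<subseteq> {w. (f v, w) \<in> edges U}"
      using f(3) that edges_verts unfolding children_def by auto
    moreover have "inj_on f (children S v)"
      by (rule inj_on_subset[OF bij_betw_imp_inj_on[OF f(1)]])
        (use edges_verts in \<open>auto simp: children_def\<close>)
    ultimately have "outdegree S v \<le> card {w. (f v, w) \<in> edges U}"
      using fin card_inj_on_le by blast
    then show ?thesis
      using comb_shape_caterpillar(1)[OF U] by (meson le_trans)
  qed
  moreover obtain p where p: "p \<noteq> []" "hd p = top_vertex U"
    "successively (\<lambda>u v. (u, v) \<in> edges U) p" "set p \<subseteq> verts U" "Domain (edges U) \<subseteq> set p"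
    using comb_shape_caterpillar(2)[OF U] by blast
  have "successively (\<lambda>u v. (g u, g v) \<in> edges S) p"
  proof (rule successively_mono[OF p(3)])
    fix x y assume xy: "x \<in> set p" "y \<in> set p" "(x, y) \<in> edges U"
    then have "x \<in> verts U" "y \<in> verts U"
      using p(4) by blast+
    then show "(g x, g y) \<in> edges S"
      using f(3)[of "g x" "g y"] fg xy(3) by metis
  qed
  then have "root_path S (map g p)"
    using p(1,2) gf[OF top_in_verts] f(2) unfolding root_path_def
    by (simp add: hd_map successively_map)
  moreover have "verts S - leaves S \<subseteq> set (map g p)"
  proof
    fix x assume x: "x \<in> verts S - leaves S"
    then obtain y where xy: "(x, y) \<in> edges S"
      unfolding leaves_def children_def by auto
    then have "(f x, f y) \<in> edges U"
      using f(3)[of x y] edges_verts by auto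
    then have "f x \<in> set p"
      using p(5) by blast
    then show "x \<in> set (map g p)"
      using gf x by force
  qed
  ultimately show ?thesis
    using S unfolding binary_caterpillar_def binary_tree_def by blast
qed

text \<open>As \<open>L\<close> is nonempty, the centre has outgoing edges, so a leaf of
  \<open>S\<close> cannot be mapped to it and goes into \<open>L\<close>.\<close>

lemma star_shape_star:
  assumes S: "topological_tree S"
    and iso: "tree_iso S \<lparr>verts = insert v L, edges = {v} \<times> L, top_vertex = v\<rparr>" and L: "L \<noteq> {}" "v \<notin> L"
  shows "star S"
proof -
  interpret rooted S
    using S unfolding topological_tree_def by unfold_locales auto
  obtain f where f: "bij_betw f (verts S) (insert v L)" "f (top_vertex S) = v"
    "\<And>u w. u \<in> verts S \<Longrightarrow> w \<in> verts S \<Longrightarrow> (u, w) \<in> edges S \<longleftrightarrow> f u = v \<and> f w \<in> L"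
    using iso unfolding tree_iso_def by auto
  have "(top_vertex S, l) \<in> edges S" if l: "l \<in> leaves S" for l
  proof -
    have lv: "l \<in> verts S" using l leaves_verts by blast
    obtain a where "a \<in> L" using L by blast
    then obtain b where "b \<in> verts S" "f b \<in> L"
      using f(1) unfolding bij_betw_def by (metis imageE insertI2)
    then have "f l \<noteq> v"
      using f(3)[OF lv] l unfolding leaves_def children_def by auto
    then have "f l \<in> L"
      using bij_betwE[OF f(1)] lv by auto
    then show ?thesis
      using f(2,3) lv top_in_verts by blast
  qed
  then show ?thesis
    using S unfolding star_def children_def by auto
qed

section \<open>Topological trees\<close>

locale topological = rooted +
  assumes branching: "v \<in> verts T - leaves T \<Longrightarrow> outdegree T v \<ge> 2"
begin

lemma two_children:
  assumes "v \<in> verts T - leaves T"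
  obtains c d where "(v, c) \<in> edges T" "(v, d) \<in> edges T" "c \<noteq> d"
proof -
  have "\<not> children T v \<subseteq> {c}" for c
    using card_mono[of "{c}" "children T v"] branching[OF assms] by auto
  then obtain c d where "c \<in> children T v" "d \<in> children T v" "c \<noteq> d"
    by blast
  then show ?thesis
    using that unfolding children_def by blast
qed

lemma leaf_under:
  assumes "v \<in> verts T"
  shows "\<exists>l \<in> leaves T. (v, l) \<in> (edges T)\<^sup>*"
  using assms
proof (induction v rule: wf_induct_rule[OF wf_converse_edges])
  case (1 v)
  show ?case
  proof (cases "v \<in> leaves T")
    case False
    then obtain c where c: "(v, c) \<in> edges T"
      using "1.prems" unfolding leaves_def children_def by auto
    then obtain l where "l \<in> leaves T" "(c, l) \<in> (edges T)\<^sup>*"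
      using "1.IH"[of c] edges_verts by auto
    then show ?thesis
      using c by (meson converse_rtrancl_into_rtrancl)
  qed auto
qed

lemma leaves_nonempty: "leaves T \<noteq> {}"
  using leaf_under top_in_verts by blast

lemma splits_leaves:
  assumes "v \<in> verts T - leaves T"
  shows "\<exists>x \<in> leaves T. \<exists>y \<in> leaves T. splits T v x y"
proof -
  obtain c d where cd: "(v, c) \<in> edges T" "(v, d) \<in> edges T" "c \<noteq> d"
    using two_children[OF assms] .
  then obtain x y where "x \<in> leaves T" "(c, x) \<in> (edges T)\<^sup>*" "y \<in> leaves T" "(d, y) \<in> (edges T)\<^sup>*"
    using leaf_under[of c] leaf_under[of d] edges_verts by auto
  then show ?thesis
    using cd unfolding splits_def by blast
qed

text \<open>With two children at each inner vertex, and leaves below both, every inner vertex is a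
  branching point of the full leaf set.\<close>

lemma kept_leaves: "kept T (leaves T) = verts T"
proof
  show "kept T (leaves T) \<subseteq> verts T"
    by (rule kept_verts) simp
  show "verts T \<subseteq> kept T (leaves T)"
    using splits_leaves unfolding kept_def by blast
qed

lemma cover_verts: "cover T (verts T) = edges T"
proof (intro equalityI subrelI)
  fix x y assume xy: "(x, y) \<in> cover T (verts T)"
  then obtain c where c: "(x, c) \<in> edges T" "(c, y) \<in> (edges T)\<^sup>*"
    unfolding cover_def by (blast dest: tranclD)
  then have "(c, y) \<notin> (edges T)\<^sup>+"
    using xy edges_verts unfolding cover_def by auto
  then show "(x, y) \<in> edges T"
    using c by (auto simp: rtrancl_eq_or_trancl)
next
  fix x y assume xy: "(x, y) \<in> edges T"
  have "\<not> ((x, z) \<in> (edges T)\<^sup>+ \<and> (z, y) \<in> (edges T)\<^sup>+)" for z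
  proof
    assume z: "(x, z) \<in> (edges T)\<^sup>+ \<and> (z, y) \<in> (edges T)\<^sup>+"
    then have "(z, x) \<in> (edges T)\<^sup>*"
      using parent_unique[OF xy] by (metis tranclD2)
    then show False
      using z acyclic by (meson trancl_rtrancl_trancl)
  qed
  then show "(x, y) \<in> cover T (verts T)"
    using xy edges_verts unfolding cover_def by auto
qed

lemma apex_leaves: "apex T (leaves T) (top_vertex T)"
proof (cases "top_vertex T \<in> leaves T")
  case True
  then have "leaves T = {top_vertex T}"
    using top_le leaf_below leaves_verts by blast
  then show ?thesis unfolding apex_def by auto
next
  case False
  then show ?thesis
    using splits_leaves[of "top_vertex T"] top_le top_in_verts leaves_verts unfolding apex_def by auto
qed

text \<open>Suppression changes nothing here, so \<open>S\<close> itself counts as an induced tree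
  when it is compared with leaf sets of large stars and caterpillars.\<close>

lemma induced_tree_leaves: "induced_tree T (leaves T) = T"
  unfolding induced_tree_eq[OF subset_refl apex_leaves] kept_leaves cover_verts by simp

lemma star_star_like:
  assumes "star T"
  shows "star_like T (top_vertex T) (leaves T)"
proof -
  have ch: "(top_vertex T, l) \<in> edges T" if "l \<in> leaves T" for l
    using assms that unfolding star_def children_def by auto
  have "top_vertex T \<notin> leaves T"
    using ch no_edge_to_top by blast
  then obtain x y where xy: "x \<in> leaves T" "y \<in> leaves T" "splits T (top_vertex T) x y"
    using splits_leaves[of "top_vertex T"] top_in_verts by blast
  then have "x \<noteq> y"
    using splits_irrefl by blast
  then have "card {x, y} = 2" by simp
  then have "card (leaves T) \<ge> 2"
    using card_mono[OF finite_leaves, of "{x, y}"] xy by simp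
  then show ?thesis
    using ch unfolding star_like_def splits_def by blast
qed

text \<open>Only inner vertices below \<open>hd p\<close> are required to lie on \<open>p\<close>, a
  condition that passes to the tail. At each vertex of the path, the child off the path must then be
  a leaf and becomes the next entry.\<close>

lemma comb_along_path:
  assumes bin: "\<And>v. v \<in> verts T \<Longrightarrow> outdegree T v \<le> 2"
    and "p \<noteq> []" "hd p \<in> verts T" "successively (\<lambda>u v. (u, v) \<in> edges T) p"
    and "\<And>x. (hd p, x) \<in> (edges T)\<^sup>* \<Longrightarrow> x \<in> verts T - leaves T \<Longrightarrow> x \<in> set p"
  shows "\<exists>ls. comb T (hd p) ls \<and> set ls = {l \<in> leaves T. (hd p, l) \<in> (edges T)\<^sup>*}"
  using assms(2-)
proof (induction p)
  case (Cons v q)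
  have v: "v \<in> verts T" using Cons.prems by simp
  show ?case
  proof (cases "v \<in> leaves T")
    case True
    then have "{l \<in> leaves T. (v, l) \<in> (edges T)\<^sup>*} = {v}"
      using leaf_below by blast
    then show ?thesis
      using comb.single[OF True] by (intro exI[of _ "[v]"]) auto
  next
    case False
    have two: "\<exists>d. (v, d) \<in> edges T \<and> c \<noteq> d \<and> children T v = {c, d}" if c: "(v, c) \<in> edges T" for c
    proof -
      have "card (children T v) = 2"
        using bin[OF v] branching[of v] v False by auto
      then obtain a b where "children T v = {a, b}" "a \<noteq> b"
        by (auto simp: card_2_iff)
      then show ?thesis
        using c unfolding children_def by (auto simp: set_eq_iff)
    qed
    have below: "{l \<in> leaves T. (v, l) \<in> (edges T)\<^sup>*} =
      (\<Union>c \<in> children T v. {l \<in> leaves T. (c, l) \<in> (edges T)\<^sup>*})"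
    proof (intro equalityI subsetI)
      fix l assume l: "l \<in> {l \<in> leaves T. (v, l) \<in> (edges T)\<^sup>*}"
      then have "(v, l) \<in> (edges T)\<^sup>*" "v \<noteq> l" using False by auto
      then obtain c where "(v, c) \<in> edges T" "(c, l) \<in> (edges T)\<^sup>*"
        by (meson converse_rtranclE)
      then show "l \<in> (\<Union>c \<in> children T v. {l \<in> leaves T. (c, l) \<in> (edges T)\<^sup>*})"
        using l unfolding children_def by auto
    qed (auto simp: children_def intro: converse_rtrancl_into_rtrancl)
    have single: "{l \<in> leaves T. (c, l) \<in> (edges T)\<^sup>*} = {c}" if "c \<in> leaves T" for c
      using that leaf_below by blast
    have sp: "splits T v c d" if "(v, c) \<in> edges T" "(v, d) \<in> edges T" "c \<noteq> d" for c d
      using that unfolding splits_def by blast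
    have off: "c \<in> leaves T" if "(v, c) \<in> edges T" "c \<notin> set (v # q)" for c
      using Cons.prems(4)[of c] that edges_verts by auto
    have cv: "c \<noteq> v" if "(v, c) \<in> edges T" for c
      using acyclic that by blast
    show ?thesis
    proof (cases q)
      \<comment> \<open>The path may stop at the lowest inner vertex; both its children are then
        leaves and form the end of the list.\<close>
      case Nil
      obtain c where c: "(v, c) \<in> edges T"
        using v False unfolding leaves_def children_def by blast
      obtain d where "(v, d) \<in> edges T" "c \<noteq> d" "children T v = {c, d}"
        using two[OF c] by blast
      note cd = c this
      then have lv: "c \<in> leaves T" "d \<in> leaves T"
        using off cv Nil by auto
      then have "comb T v [c, d]"
        by (intro comb.cons[OF sp[OF cd(1-3)]] comb.single)
      moreover have "set [c, d] = {l \<in> leaves T. (v, l) \<in> (edges T)\<^sup>*}"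
        unfolding below cd(4) by (simp add: single lv insert_commute)
      ultimately show ?thesis by (metis list.sel(1))
    next
      case (Cons w r)
      then have w: "(v, w) \<in> edges T" and suc: "successively (\<lambda>u v. (u, v) \<in> edges T) q"
        using Cons.prems(3) by auto
      have "\<exists>ls. comb T (hd q) ls \<and> set ls = {l \<in> leaves T. (hd q, l) \<in> (edges T)\<^sup>*}"
      proof (rule Cons.IH)
        show "q \<noteq> []" "hd q \<in> verts T"
          using Cons w edges_verts by auto
        show "successively (\<lambda>u v. (u, v) \<in> edges T) q" by fact
        fix x assume x: "(hd q, x) \<in> (edges T)\<^sup>*" "x \<in> verts T - leaves T"
        then have "(v, x) \<in> (edges T)\<^sup>+"
          using w Cons by (auto intro: rtrancl_into_trancl2)
        then have "x \<noteq> v" "x \<in> set (v # q)"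
          using acyclic Cons.prems(4)[of x] x(2) by (auto intro: trancl_into_rtrancl)
        then show "x \<in> set q" by simp
      qed
      then obtain ls where ls: "comb T w ls" "set ls = {l \<in> leaves T. (w, l) \<in> (edges T)\<^sup>*}"
        using Cons by auto
      obtain c where c: "(v, c) \<in> edges T" "w \<noteq> c" "children T v = {w, c}"
        using two[OF w] by blast
      \<comment> \<open>This excludes that the sibling \<open>c\<close> of \<open>w\<close> occurs
        later on the path: everything there is below \<open>w\<close>.\<close>
      have path: "(w, x) \<in> (edges T)\<^sup>*" if "x \<in> set q" for x
      proof -
        have "successively (\<lambda>u v. (u, v) \<in> (edges T)\<^sup>*) q"
          by (rule successively_mono[OF suc]) auto
        moreover have "transp (\<lambda>u v. (u, v) \<in> (edges T)\<^sup>*)"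
          by (rule transpI) (rule rtrancl_trans)
        ultimately have "sorted_wrt (\<lambda>u v. (u, v) \<in> (edges T)\<^sup>*) q"
          by (simp add: successively_conv_sorted_wrt)
        then show ?thesis using that Cons by auto
      qed
      have "c \<notin> set q"
        using path[of c] child_unique[OF w c(1), of c] c(2) by auto
      then have cl: "c \<in> leaves T"
        using off cv c(1) by simp
      then have "comb T v (c # ls)"
        using comb.cons[OF sp[OF c(1) w] cl ls(1)] c(2) by simp
      moreover have "set (c # ls) = {l \<in> leaves T. (v, l) \<in> (edges T)\<^sup>*}"
        unfolding below c(3) using single[OF cl] ls(2) by auto
      ultimately show ?thesis by (metis list.sel(1))
    qed
  qed
qed simp

text \<open>Induction down the tree: where the leaves below \<^term>\<open>v\<close> spread over at least \<^term>\<open>k\<close> children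
  there is a star; otherwise some child keeps a \<open>1 / k\<close> fraction of them, and a leaf below another
  child extends the caterpillar found there.\<close>

lemma star_or_comb:
  assumes k: "k \<ge> 2" and M: "M \<subseteq> leaves T"
    and "v \<in> verts T" "k ^ j \<le> card {l \<in> M. (v, l) \<in> (edges T)\<^sup>*}"
  shows "(\<exists>u L. star_like T u L \<and> L \<subseteq> M \<and> card L = k) \<or>
    (\<exists>w ls. comb T w ls \<and> (v, w) \<in> (edges T)\<^sup>* \<and> set ls \<subseteq> M \<and> length ls = Suc j)"
  using assms(3-)
proof (induction v arbitrary: j rule: wf_induct_rule[OF wf_converse_edges])
  case (1 v)
  define D where "D v = {l \<in> M. (v, l) \<in> (edges T)\<^sup>*}" for v
  have finD: "finite (D x)" for x
    using finite_subset[OF M finite_leaves] unfolding D_def by simp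
  have card: "k ^ j \<le> card (D v)"
    using "1.prems" unfolding D_def by simp
  show ?case
  proof (cases j)
    case 0
    then have "D v \<noteq> {}" using card by auto
    then obtain l where "l \<in> M" "(v, l) \<in> (edges T)\<^sup>*"
      unfolding D_def by blast
    moreover have "comb T l [l]"
      using calculation(1) M by (auto intro: comb.single)
    ultimately have "comb T l [l] \<and> (v, l) \<in> (edges T)\<^sup>* \<and> set [l] \<subseteq> M \<and> length [l] = Suc j"
      using 0 by simp
    then show ?thesis by blast
  next
    case (Suc i)
    have "k \<le> k * k ^ i"
      using k by simp
    then have "2 \<le> card (D v)"
      using card[unfolded Suc power_Suc] k by linarith
    have v: "v \<notin> leaves T"
    proof
      assume "v \<in> leaves T"
      then have "D v \<subseteq> {v}" using leaf_below unfolding D_def by blast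
      then have "card (D v) \<le> 1" using card_mono[of "{v}" "D v"] by simp
      then show False using \<open>2 \<le> card (D v)\<close> by simp
    qed
    \<comment> \<open>Branches without members of \<open>M\<close> contribute nothing to a star or a
      comb inside \<open>M\<close>, so the degree is measured by \<open>C\<close> only.\<close>
    define C where "C = {c \<in> children T v. D c \<noteq> {}}"
    have finC: "finite C"
      using finite_children unfolding C_def by simp
    have Ce: "(v, c) \<in> edges T" if "c \<in> C" for c
      using that unfolding C_def children_def by simp
    have DC: "D v = (\<Union>c \<in> C. D c)"
    proof (intro equalityI subsetI)
      fix l assume l: "l \<in> D v"
      then have "(v, l) \<in> (edges T)\<^sup>*" "v \<noteq> l"
        using v M unfolding D_def by auto
      then obtain c where "(v, c) \<in> edges T" "(c, l) \<in> (edges T)\<^sup>*"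
        by (meson converse_rtranclE)
      then have "l \<in> D c" "c \<in> C"
        using l unfolding C_def D_def children_def by auto
      then show "l \<in> (\<Union>c \<in> C. D c)" by blast
    next
      fix l assume "l \<in> (\<Union>c \<in> C. D c)"
      then show "l \<in> D v"
        using Ce unfolding D_def by (auto intro: converse_rtrancl_into_rtrancl)
    qed
    show ?thesis
    proof (cases "k \<le> card C")
      case True
      then obtain C' where C': "C' \<subseteq> C" "card C' = k"
        by (meson obtain_subset_with_card_n)
      define g where "g c = (SOME l. l \<in> D c)" for c
      have g: "g c \<in> D c" if "c \<in> C" for c
        using that unfolding g_def C_def by (auto intro: someI_ex)
      have sp: "splits T v (g c) (g d)" if "c \<in> C'" "d \<in> C'" "c \<noteq> d" for c d
        using that g[of c] g[of d] C' Ce[of c] Ce[of d] unfolding splits_def D_def by blast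
      have "inj_on g C'"
        using sp splits_irrefl by (metis inj_onI)
      then have "card (g ` C') = k"
        using C' card_image by blast
      moreover have "g ` C' \<subseteq> M"
        using g C' unfolding D_def by auto
      moreover have "star_like T v (g ` C')"
        using calculation M k sp unfolding star_like_def by auto
      ultimately show ?thesis by blast
    next
      case False
      obtain c where c: "c \<in> C" "k ^ i \<le> card (D c)"
      proof (rule ccontr)
        assume "\<not> thesis"
        \<comment> \<open>The weak bound is enough for the pigeonhole argument: strictness comes
          from \<open>card C < k\<close>.\<close>
        then have "\<forall>c \<in> C. card (D c) \<le> k ^ i"
          using that by (meson nle_le)
        then have "card (D v) \<le> card C * k ^ i"
          unfolding DC using card_UN_le[OF finC, of D] sum_bounded_above[of C "\<lambda>c. card (D c)" "k ^ i"]
          by simp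
        also have "\<dots> < k ^ j"
          using False k Suc by simp
        finally show False using card by simp
      qed
      have cv: "c \<in> verts T" and vc: "(v, c) \<in> edges T"
        using Ce[OF c(1)] edges_verts by auto
      show ?thesis
      \<comment> \<open>With one relevant child there is no leaf to attach, but none of
        \<open>D v\<close> is lost either: the descent continues with the same
        \<open>j\<close>.\<close>
      proof (cases "C = {c}")
        case True
        then have "k ^ j \<le> card {l \<in> M. (c, l) \<in> (edges T)\<^sup>*}"
          using card DC unfolding D_def by simp
        from "1.IH"[OF _ cv this] vc show ?thesis
          by (meson converse_iff converse_rtrancl_into_rtrancl)
      next
        case False
        then obtain d where d: "d \<in> C" "d \<noteq> c" using c by blast
        then obtain l where l: "l \<in> M" "(d, l) \<in> (edges T)\<^sup>*"
          unfolding C_def D_def by blast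
        have "(c, v) \<in> (edges T)\<inverse>" using vc by simp
        from "1.IH"[OF this cv] c(2) consider
          "\<exists>u L. star_like T u L \<and> L \<subseteq> M \<and> card L = k"
          | w ls where "comb T w ls" "(c, w) \<in> (edges T)\<^sup>*" "set ls \<subseteq> M" "length ls = Suc i"
          unfolding D_def by blast
        then show ?thesis
        proof cases
          case 2
          have "splits T v l w"
            using vc Ce[OF d(1)] d(2) l(2) 2(2) unfolding splits_def by blast
          then have "comb T v (l # ls)"
            using comb.cons[OF _ _ 2(1)] l(1) M by auto
          moreover have "set (l # ls) \<subseteq> M" "length (l # ls) = Suc j"
            using l 2 Suc by auto
          ultimately show ?thesis by blast
        qed blast
      qed
    qed
  qed
qed

text \<open>The exponent \<open>k - 1\<close> makes the comb have exactly \<open>k\<close> leaves.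
  The case \<open>k = 1\<close> is separate because a star needs two leaves; one leaf is a
  comb.\<close>

lemma exists_star_or_comb:
  assumes M: "M \<subseteq> leaves T" and k: "k \<ge> 1" and card: "k ^ (k - 1) \<le> card M"
  shows "\<exists>L \<subseteq> M. card L = k \<and> ((\<exists>v. star_like T v L) \<or> (\<exists>v ls. comb T v ls \<and> set ls = L))"
proof (cases "k = 1")
  case True
  then obtain l where "l \<in> M" using card by fastforce
  moreover have "comb T l [l]" using calculation M by (auto intro: comb.single)
  ultimately show ?thesis
    using True by (intro exI[of _ "{l}"]) (auto intro!: exI[of _ "[l]"])
next
  case False
  have "{l \<in> M. (top_vertex T, l) \<in> (edges T)\<^sup>*} = M"
    using M leaves_verts top_le by auto
  then consider v L where "star_like T v L" "L \<subseteq> M" "card L = k"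
    | w ls where "comb T w ls" "set ls \<subseteq> M" "length ls = Suc (k - 1)"
    using star_or_comb[OF _ M top_in_verts, of k "k - 1"] card False k by fastforce
  then show ?thesis
  proof cases
    case 2
    then have "card (set ls) = k"
      using comb_distinct k by (simp add: distinct_card)
    then show ?thesis using 2 by blast
  qed blast
qed

lemma binary_caterpillar_comb:
  assumes "binary_caterpillar T"
  shows "\<exists>ls. comb T (top_vertex T) ls \<and> set ls = leaves T"
proof -
  obtain p where "root_path T p" "verts T - leaves T \<subseteq> set p"
    and bin: "\<And>v. v \<in> verts T \<Longrightarrow> outdegree T v \<le> 2"
    using assms unfolding binary_caterpillar_def binary_tree_def by blast
  then have "\<exists>ls. comb T (hd p) ls \<and> set ls = {l \<in> leaves T. (hd p, l) \<in> (edges T)\<^sup>*}"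
    using top_in_verts by (intro comb_along_path) (auto simp: root_path_def)
  moreover have "hd p = top_vertex T"
    using \<open>root_path T p\<close> unfolding root_path_def by simp
  ultimately show ?thesis
    using top_le leaves_verts by (auto simp: subset_iff)
qed

end

lemma topological_iff: "topological_tree T \<longleftrightarrow> topological T"
  unfolding topological_tree_def topological_def topological_axioms_def rooted_def by blast

lemma not_tree_iso_star_or_comb:
  assumes S: "topological_tree S" "\<not> star S" "\<not> binary_caterpillar S" and T: "topological_tree T"
    and L: "(\<exists>v. star_like T v L) \<or> (\<exists>v ls. comb T v ls \<and> set ls = L)"
  shows "\<not> tree_iso S (induced_tree T L)"
proof -
  interpret topological T using T by (simp add: topological_iff)
  from L show ?thesis
  proof (elim disjE exE conjE)
    fix v assume v: "star_like T v L"
    then have "L \<noteq> {}" unfolding star_like_def by auto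
    then show ?thesis
      using star_shape_star[OF S(1)] star_like_induced[OF v] S(2) by metis
  next
    fix v ls assume "comb T v ls" "set ls = L"
    then show ?thesis
      using comb_induced comb_shape_binary_caterpillar[OF S(1)] S(3) by fastforce
  qed
qed

section \<open>Counting copies\<close>

text \<open>\<open>tree_iso\<close> compares edges between listed vertices only, whereas
  \<open>children\<close> ranges over the whole type; the two containments close this gap.\<close>

lemma tree_iso_card_leaves:
  assumes iso: "tree_iso S U"
    and "edges S \<subseteq> verts S \<times> verts S" "edges U \<subseteq> verts U \<times> verts U"
  shows "card (leaves S) = card (leaves U)"
proof -
  obtain f where f: "bij_betw f (verts S) (verts U)"
    "\<And>u v. u \<in> verts S \<Longrightarrow> v \<in> verts S \<Longrightarrow> (u, v) \<in> edges S \<longleftrightarrow> (f u, f v) \<in> edges U"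
    using iso unfolding tree_iso_def by blast
  have surj: "f ` verts S = verts U"
    using f(1) bij_betw_imp_surj_on by blast
  have lv: "x \<in> leaves S \<longleftrightarrow> f x \<in> leaves U" if x: "x \<in> verts S" for x
  proof -
    have "children S x = {} \<longleftrightarrow> (\<forall>y \<in> verts S. (x, y) \<notin> edges S)"
      using assms(2) unfolding children_def by auto
    also have "\<dots> \<longleftrightarrow> (\<forall>y \<in> verts U. (f x, y) \<notin> edges U)"
      using f(2)[OF x] unfolding surj[symmetric] by auto
    also have "\<dots> \<longleftrightarrow> children U (f x) = {}"
      using assms(3) unfolding children_def by auto
    finally show ?thesis
      using x surj unfolding leaves_def by auto
  qed
  have "f ` leaves S = leaves U"
  proof -
    have "leaves U \<subseteq> f ` verts S" "leaves S \<subseteq> verts S"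
      unfolding surj leaves_def by auto
    then show ?thesis using lv by blast
  qed
  moreover have "inj_on f (leaves S)"
    by (rule inj_on_subset[OF bij_betw_imp_inj_on[OF f(1)]]) (auto simp: leaves_def)
  ultimately show ?thesis
    using card_image by fastforce
qed

lemma copy_card:
  assumes S: "topological_tree S" and T: "topological_tree T"
    and L: "L \<subseteq> leaves T" "L \<noteq> {}" and iso: "tree_iso S (induced_tree T L)"
  shows "card L = card (leaves S)"
proof -
  interpret S: topological S using S by (simp add: topological_iff)
  interpret T: topological T using T by (simp add: topological_iff)
  have "edges (induced_tree T L) \<subseteq> verts (induced_tree T L) \<times> verts (induced_tree T L)"
    unfolding induced_tree_def suppress_def Let_def by auto
  from tree_iso_card_leaves[OF iso S.edges_verts this] show ?thesis
    using T.leaves_induced_tree[OF L] by simp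
qed

lemma copies_eq:
  assumes S: "topological_tree S" and T: "topological_tree T"
  shows "copies S T =
    card {L. L \<subseteq> leaves T \<and> card L = card (leaves S) \<and> tree_iso S (induced_tree T L)}"
proof -
  interpret S: topological S using S by (simp add: topological_iff)
  have "card (leaves S) \<noteq> 0"
    using S.leaves_nonempty S.finite_leaves by simp
  then show ?thesis
    unfolding copies_def by (intro arg_cong[of _ _ card]) (auto dest: copy_card[OF S T])
qed

lemma copies_le:
  assumes S: "topological_tree S" and T: "topological_tree T"
  shows "copies S T \<le> card (leaves T) choose card (leaves S)"
proof -
  interpret T: topological T using T by (simp add: topological_iff)
  show ?thesis
    unfolding copies_eq[OF S T] n_subsets[OF T.finite_leaves, symmetric]
    by (intro card_mono) (auto simp: T.finite_leaves)
qed

lemma tree_density_le_1: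
  assumes "topological_tree S" "topological_tree T"
  shows "tree_density S T \<le> 1"
  using copies_le[OF assms] unfolding tree_density_def by (auto simp: divide_le_eq_1)

lemma tree_density_eq_1:
  assumes S: "topological_tree S" and T: "topological_tree T"
    and le: "card (leaves S) \<le> card (leaves T)"
    and all: "\<And>L. L \<subseteq> leaves T \<Longrightarrow> card L = card (leaves S) \<Longrightarrow> tree_iso S (induced_tree T L)"
  shows "tree_density S T = 1"
proof -
  interpret T: topological T using T by (simp add: topological_iff)
  have "copies S T = card {L. L \<subseteq> leaves T \<and> card L = card (leaves S)}"
    unfolding copies_eq[OF S T] using all by (intro arg_cong[of _ _ card]) auto
  then show ?thesis
    using le unfolding tree_density_def n_subsets[OF T.finite_leaves] by simp
qed

text \<open>Double counting of pairs \<open>L \<subseteq> M\<close> with \<open>L\<close> in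
  \<open>B\<close>: each \<open>m\<close>-set contains some such \<open>L\<close>, and each
  \<open>L\<close> lies in \<open>?c\<close> of them. The identity \<open>choose_mult\<close> then
  turns \<open>m\<close>-sets into \<open>k\<close>-sets and lets \<open>?c\<close> cancel.\<close>

lemma card_blocking_family:
  assumes A: "finite A" and B: "B \<subseteq> {L. L \<subseteq> A \<and> card L = k}"
    and block: "\<And>M. M \<subseteq> A \<Longrightarrow> card M = m \<Longrightarrow> \<exists>L \<in> B. L \<subseteq> M"
    and le: "k \<le> m" "m \<le> card A"
  shows "card A choose k \<le> card B * (m choose k)"
proof -
  let ?c = "(card A - k) choose (m - k)"
  let ?U = "\<lambda>L. {M. L \<subseteq> M \<and> M \<subseteq> A \<and> card M = m}"
  have finB: "finite B"
    using finite_subset[OF B] A by simp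
  have up: "card (?U L) \<le> ?c" if "L \<in> B" for L
  proof -
    have L: "L \<subseteq> A" "card L = k" "finite L"
      using that B finite_subset[OF _ A] by auto
    have "card (?U L) \<le> card {N. N \<subseteq> A - L \<and> card N = m - k}"
    proof (rule card_inj_on_le)
      show "inj_on (\<lambda>M. M - L) (?U L)"
        by (rule inj_onI) blast
      show "(\<lambda>M. M - L) ` ?U L \<subseteq> {N. N \<subseteq> A - L \<and> card N = m - k}"
        using L by (auto simp: card_Diff_subset)
      show "finite {N. N \<subseteq> A - L \<and> card N = m - k}"
        using A by simp
    qed
    also have "\<dots> = ?c"
      using L A by (simp add: n_subsets card_Diff_subset)
    finally show ?thesis .
  qed
  have "card A choose m = card {M. M \<subseteq> A \<and> card M = m}"
    using A by (simp add: n_subsets)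
  also have "\<dots> \<le> card (\<Union>L \<in> B. ?U L)"
  proof (rule card_mono)
    show "finite (\<Union>L \<in> B. ?U L)" using finB A by simp
    show "{M. M \<subseteq> A \<and> card M = m} \<subseteq> (\<Union>L \<in> B. ?U L)"
      using block by blast
  qed
  also have "\<dots> \<le> (\<Sum>L \<in> B. card (?U L))"
    by (rule card_UN_le[OF finB])
  also have "\<dots> \<le> card B * ?c"
    using sum_bounded_above[of B "\<lambda>L. card (?U L)" ?c] up by simp
  finally have "(card A choose m) * (m choose k) \<le> card B * ?c * (m choose k)"
    by (rule mult_le_mono1)
  then have "?c * (card A choose k) \<le> ?c * (card B * (m choose k))"
    unfolding choose_mult[OF le] by (simp only: mult_ac)
  moreover have "?c > 0"
    using le by simp
  ultimately show ?thesis by simp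
qed

text \<open>The \<open>k\<close>-sets that do not induce \<open>S\<close> meet the blocking
  condition, since every \<open>m\<close>-set contains a star or a comb of size \<open>k\<close>.
  What matters is that the bound involves \<open>m\<close> and \<open>k\<close> only, not the size
  of \<open>T\<close>.\<close>

lemma tree_density_bound:
  assumes S: "topological_tree S" "\<not> star S" "\<not> binary_caterpillar S" and T: "topological_tree T"
    and k: "k = card (leaves S)" and m: "k \<le> m" "k ^ (k - 1) \<le> m" "m \<le> card (leaves T)"
  shows "tree_density S T \<le> 1 - 1 / real (m choose k)"
proof -
  interpret S: topological S using S(1) by (simp add: topological_iff)
  interpret T: topological T using T by (simp add: topological_iff)
  let ?n = "card (leaves T)"
  let ?A = "{L. L \<subseteq> leaves T \<and> card L = k}"
  let ?G = "{L \<in> ?A. tree_iso S (induced_tree T L)}"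
  define B where "B = {L \<in> ?A. \<not> tree_iso S (induced_tree T L)}"
  have k1: "k \<ge> 1"
    using S.leaves_nonempty S.finite_leaves unfolding k by (simp add: Suc_le_eq card_gt_0_iff)
  have finA: "finite ?A" using T.finite_leaves by simp
  have "?n choose k \<le> card B * (m choose k)"
  proof (rule card_blocking_family[OF T.finite_leaves])
    fix M assume M: "M \<subseteq> leaves T" "card M = m"
    then have "k ^ (k - 1) \<le> card M" using m by simp
    from T.exists_star_or_comb[OF M(1) k1 this]
    obtain L where L: "L \<subseteq> M" "card L = k"
      "(\<exists>v. star_like T v L) \<or> (\<exists>v ls. comb T v ls \<and> set ls = L)"
      by (elim exE conjE) (rule that)
    have "L \<in> B"
      using not_tree_iso_star_or_comb[OF S T L(3)] L M(1) unfolding B_def by auto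
    then show "\<exists>L \<in> B. L \<subseteq> M"
      using L(1) by blast
  qed (use m in \<open>auto simp: B_def\<close>)
  then have blk: "real (?n choose k) \<le> real (card B) * real (m choose k)"
    by (metis of_nat_le_iff of_nat_mult)
  have "card ?G + card B = card (?G \<union> B)"
  proof (rule card_Un_disjoint[symmetric])
    show "finite ?G" "finite B"
      by (rule finite_subset[OF _ finA]; auto simp: B_def)+
  qed (auto simp: B_def)
  also have "?G \<union> B = ?A" unfolding B_def by blast
  also have "card ?A = ?n choose k"
    by (rule n_subsets[OF T.finite_leaves])
  finally have "card ?G + card B = ?n choose k" .
  moreover have "copies S T = card ?G"
    unfolding copies_eq[OF S(1) T] k by (simp add: conj_assoc)
  ultimately have sum: "real (copies S T) = real (?n choose k) - real (card B)"
    by linarith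
  have pos: "real (?n choose k) > 0" "real (m choose k) > 0"
    using m by auto
  have "1 / real (m choose k) \<le> real (card B) / real (?n choose k)"
    using blk pos by (simp add: field_simps)
  then show ?thesis
    using pos unfolding tree_density_def k[symmetric] sum by (simp add: diff_divide_distrib)
qed

section \<open>Stars and combs of equal size are isomorphic across trees\<close>

lemma star_like_iso:
  assumes S: "topological_tree S" "star_like S r L" and T: "topological_tree T" "star_like T v M"
    and card: "card L = card M"
  shows "tree_iso (induced_tree S L) (induced_tree T M)"
proof -
  interpret S: topological S using S by (simp add: topological_iff)
  interpret T: topological T using T by (simp add: topological_iff)
  note s = S.star_like_induced[OF S(2)] and t = T.star_like_induced[OF T(2)]
  have "finite L" "finite M"
    using S(2) T(2) finite_subset S.finite_leaves T.finite_leaves unfolding star_like_def by blast+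
  then obtain g where g: "bij_betw g L M"
    using card finite_same_card_bij by blast
  define f where "f = g(r := v)"
  have fr: "f r = v" and fL: "\<And>x. x \<in> L \<Longrightarrow> f x = g x"
    using s(2) unfolding f_def by auto
  have fM: "f x \<in> M" "f x \<noteq> v" if "x \<in> L" for x
    using bij_betwE[OF g] fL that t(2) by auto
  have "bij_betw f L M"
    using g fL by (simp cong: bij_betw_cong)
  then have bij: "bij_betw f (insert r L) (insert v M)"
    using notIn_Un_bij_betw[of r L f M] s(2) t(2) fr by simp
  have "\<forall>x \<in> insert r L. \<forall>y \<in> insert r L. (x, y) \<in> {r} \<times> L \<longleftrightarrow> (f x, f y) \<in> {v} \<times> M"
    using fr fM s(2) t(2) by auto
  then show ?thesis
    unfolding tree_iso_def s(1) t(1) using bij fr by auto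
qed

lemma comb_iso:
  assumes S: "topological_tree S" "comb S r ls" and T: "topological_tree T" "comb T v ms"
    and len: "length ls = length ms"
  shows "tree_iso (induced_tree S (set ls)) (induced_tree T (set ms))"
proof -
  interpret S: topological S using S by (simp add: topological_iff)
  interpret T: topological T using T by (simp add: topological_iff)
  obtain V E where s: "induced_tree S (set ls) = \<lparr>verts = V, edges = E, top_vertex = r\<rparr>"
    "comb_shape V E r (length ls)"
    using S.comb_induced[OF S(2)] by blast
  obtain W F where t: "induced_tree T (set ms) = \<lparr>verts = W, edges = F, top_vertex = v\<rparr>"
    "comb_shape W F v (length ls)"
    using T.comb_induced[OF T(2)] len by auto
  show ?thesis
    unfolding tree_iso_def s(1) t(1) using comb_shape_iso[OF s(2) t(2)] by simp
qed

section \<open>Large stars and caterpillars\<close>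

definition nat_star :: "nat \<Rightarrow> nat rtree" where
  "nat_star n = \<lparr>verts = {..n}, edges = {0} \<times> {1..n}, top_vertex = 0\<rparr>"

lemma nat_star_leaves: "n \<ge> 1 \<Longrightarrow> leaves (nat_star n) = {1..n}"
  unfolding leaves_def children_def nat_star_def by (auto simp: Suc_le_eq)

lemma nat_star_topological:
  assumes "n \<ge> 2"
  shows "topological_tree (nat_star n)"
proof -
  have "(0, x) \<in> ({0} \<times> {1..n})\<^sup>*" if "x \<le> n" for x
    using that by (cases "x = 0") auto
  moreover have "children (nat_star n) 0 = {1..n}"
    unfolding children_def nat_star_def by auto
  ultimately show ?thesis
    using assms unfolding topological_tree_def rooted_tree_def
    by (auto simp: nat_star_leaves) (auto simp: nat_star_def Suc_le_eq)
qed

lemma nat_star_star_like: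
  assumes "L \<subseteq> {1..n}" "card L \<ge> 2"
  shows "star_like (nat_star n) 0 L"
proof -
  have "L \<noteq> {}" using assms(2) by auto
  then have "n \<ge> 1" using assms(1) by (cases n) auto
  moreover have "splits (nat_star n) 0 l l'" if "l \<in> L" "l' \<in> L" "l \<noteq> l'" for l l'
    using that assms(1) unfolding splits_def nat_star_def by (intro exI[of _ l] exI[of _ l']) auto
  ultimately show ?thesis
    using assms nat_star_leaves unfolding star_like_def by auto
qed

text \<open>The internal vertices are the even numbers below \<open>2 * n\<close>.\<close>

definition nat_comb :: "nat \<Rightarrow> nat rtree" where
  "nat_comb n = \<lparr>verts = {..2 * n},
     edges = {(x, y). even x \<and> x < 2 * n \<and> (y = x + 1 \<or> y = x + 2)}, top_vertex = 0\<rparr>"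

lemma nat_comb_leaves: "leaves (nat_comb n) = insert (2 * n) ((\<lambda>i. 2 * i + 1) ` {..<n})"
proof -
  have "leaves (nat_comb n) = insert (2 * n) {x. odd x \<and> x \<le> 2 * n}"
    unfolding leaves_def children_def nat_comb_def by auto
  moreover have "{x. odd x \<and> x \<le> 2 * n} = (\<lambda>i. 2 * i + 1) ` {..<n}"
  proof (intro equalityI subsetI)
    fix x assume "x \<in> {x. odd x \<and> x \<le> 2 * n}"
    then obtain i where "x = 2 * i + 1" "x \<le> 2 * n"
      by (blast elim: oddE)
    then show "x \<in> (\<lambda>i. 2 * i + 1) ` {..<n}" by auto
  qed auto
  ultimately show ?thesis by simp
qed

text \<open>The parameter counts inner vertices, so the caterpillar with \<open>n\<close> leaves is
  \<open>nat_comb (n - 1)\<close>.\<close>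

lemma card_nat_comb_leaves: "card (leaves (nat_comb n)) = Suc n"
proof -
  have "2 * n \<notin> (\<lambda>i. 2 * i + 1) ` {..<n}"
    by (auto dest: arg_cong[of _ _ even])
  moreover have "inj_on (\<lambda>i. 2 * i + 1 :: nat) {..<n}"
    by (rule inj_onI) simp
  ultimately show ?thesis
    unfolding nat_comb_leaves by (simp add: card_image)
qed

lemma nat_comb_reach:
  assumes "2 * i \<le> x" "x \<le> 2 * n"
  shows "(2 * i, x) \<in> (edges (nat_comb n))\<^sup>*"
  using assms
proof (induction x rule: less_induct)
  case (less x)
  show ?case
  proof (cases "x = 2 * i")
    case False
    \<comment> \<open>The parent of \<open>x\<close>: the largest even number smaller than
      \<open>x\<close>.\<close>
    define y where "y = (if even x then x - 2 else x - 1)"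
    have "x > 2 * i" using False less.prems by simp
    then have y: "y < x" "2 * i \<le> y" "even y" "x = y + 1 \<or> x = y + 2"
      unfolding y_def by (auto elim!: evenE oddE)
    then have "(2 * i, y) \<in> (edges (nat_comb n))\<^sup>*"
      using less by simp
    moreover have "(y, x) \<in> edges (nat_comb n)"
      using y less.prems unfolding nat_comb_def by auto
    ultimately show ?thesis by (rule rtrancl_into_rtrancl)
  qed simp
qed

lemma nat_comb_topological: "topological_tree (nat_comb n)"
proof -
  have "\<exists>!u. (u, v) \<in> edges (nat_comb n)" if "v \<in> verts (nat_comb n) - {top_vertex (nat_comb n)}" for v
  proof -
    define u where "u = (if even v then v - 2 else v - 1)"
    have v: "v \<le> 2 * n" "v > 0"
      using that unfolding nat_comb_def by auto
    then have "(u, v) \<in> edges (nat_comb n)"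
      unfolding u_def nat_comb_def by (auto elim!: evenE oddE)
    moreover have "w = u" if "(w, v) \<in> edges (nat_comb n)" for w
      using that unfolding u_def nat_comb_def by auto
    ultimately show ?thesis by blast
  qed
  moreover have "(top_vertex (nat_comb n), v) \<in> (edges (nat_comb n))\<^sup>*" if "v \<in> verts (nat_comb n)" for v
    using nat_comb_reach[of 0 v n] that by (simp add: nat_comb_def)
  moreover have "edges (nat_comb n) \<subseteq> verts (nat_comb n) \<times> verts (nat_comb n)"
    unfolding nat_comb_def by (auto elim!: evenE)
  moreover have "outdegree (nat_comb n) v \<ge> 2" if "v \<in> verts (nat_comb n) - leaves (nat_comb n)" for v
  proof -
    have "children (nat_comb n) v = {v + 1, v + 2}"
      using that unfolding leaves_def children_def nat_comb_def by auto
    then show ?thesis by simp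
  qed
  ultimately show ?thesis
    unfolding topological_tree_def rooted_tree_def by (auto simp: nat_comb_def)
qed

text \<open>Numerical order lists leaves from the top down, so every nonempty leaf set forms a comb.
  The second conjunct strengthens the induction: it places the apex of the rest below the spine
  vertex following the one where the next leaf splits off.\<close>

lemma nat_comb_comb:
  assumes "sorted_wrt (<) ls" "ls \<noteq> []" "set ls \<subseteq> leaves (nat_comb n)"
  shows "\<exists>w. comb (nat_comb n) w ls \<and> (\<forall>i. 2 * i \<le> hd ls \<longrightarrow> (2 * i, w) \<in> (edges (nat_comb n))\<^sup>*)"
  using assms
proof (induction ls)
  case (Cons l ls)
  let ?E = "edges (nat_comb n)"
  have l: "l \<in> leaves (nat_comb n)" using Cons.prems by simp
  have bound: "x \<le> 2 * n" if "x \<in> leaves (nat_comb n)" for x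
    using that unfolding nat_comb_leaves by auto
  show ?case
  proof (cases "ls = []")
    case True
    then show ?thesis
      using comb.single[OF l] nat_comb_reach bound[OF l] by auto
  next
    case False
    then obtain w where w: "comb (nat_comb n) w ls" "\<And>i. 2 * i \<le> hd ls \<Longrightarrow> (2 * i, w) \<in> ?E\<^sup>*"
      using Cons by auto
    have "l < hd ls" "hd ls \<le> 2 * n"
      using Cons.prems bound[of "hd ls"] hd_in_set[OF False] by auto
    \<comment> \<open>A leaf with a larger leaf after it is not the bottom leaf
      \<open>2 * n\<close>, so it is odd and hangs off the spine vertex
      \<open>2 * j\<close>.\<close>
    then obtain j where j: "l = 2 * j + 1" "j < n"
      using l unfolding nat_comb_leaves by auto
    have edge: "(2 * j, l) \<in> ?E" "(2 * j, 2 * (j + 1)) \<in> ?E"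
      using j unfolding nat_comb_def by auto
    have "(2 * (j + 1), w) \<in> ?E\<^sup>*"
      using w(2)[of "j + 1"] \<open>l < hd ls\<close> j by simp
    moreover have "l \<noteq> 2 * (j + 1)" using j by presburger
    ultimately have "splits (nat_comb n) (2 * j) l w"
      using edge unfolding splits_def by blast
    then have "comb (nat_comb n) (2 * j) (l # ls)"
      using comb.cons l w(1) by metis
    moreover have "(2 * i, 2 * j) \<in> ?E\<^sup>*" if "2 * i \<le> hd (l # ls)" for i
      using that j nat_comb_reach[of i "2 * j" n] by simp
    ultimately show ?thesis by blast
  qed
qed simp

section \<open>Inducibility\<close>

text \<open>All these densities share one denominator, and their numerators are bounded; without
  finiteness nothing could be said about \<open>Max\<close>.\<close>

lemma finite_densities:
  assumes "topological_tree S"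
  shows "finite {tree_density S T | T :: nat rtree. topological_tree T \<and> card (leaves T) = n}"
proof (rule finite_subset)
  let ?b = "n choose card (leaves S)"
  show "{tree_density S T | T :: nat rtree. topological_tree T \<and> card (leaves T) = n} \<subseteq>
      (\<lambda>c. real c / real ?b) ` {..?b}"
    using copies_le[OF assms] unfolding tree_density_def by auto
qed simp

text \<open>\<open>Max\<close> also needs a nonempty set; for \<open>n \<ge> 1\<close> the
  caterpillar with \<open>n\<close> leaves supplies a member.\<close>

lemma max_density_le:
  assumes S: "topological_tree S" and n: "n \<ge> 1"
    and le: "\<And>T :: nat rtree. topological_tree T \<Longrightarrow> card (leaves T) = n \<Longrightarrow> tree_density S T \<le> b"
  shows "max_density S n \<le> b"
proof -
  have "topological_tree (nat_comb (n - 1))" "card (leaves (nat_comb (n - 1))) = n"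
    using nat_comb_topological card_nat_comb_leaves n by auto
  then show ?thesis
    unfolding max_density_def using le by (subst Max_le_iff[OF finite_densities[OF S]]) auto
qed

lemma max_density_eq_1:
  fixes T :: "nat rtree"
  assumes S: "topological_tree S" and T: "topological_tree T" "card (leaves T) = n"
    and d: "tree_density S T = 1"
  shows "max_density S n = 1"
proof (rule antisym)
  interpret T: topological T using T by (simp add: topological_iff)
  have "n \<ge> 1"
    using T.leaves_nonempty T.finite_leaves T(2) by (metis card_0_eq less_one not_le)
  then show "max_density S n \<le> 1"
    using max_density_le[OF S] tree_density_le_1[OF S] by blast
  show "1 \<le> max_density S n"
    unfolding max_density_def
    by (rule Max_ge[OF finite_densities[OF S]]) (use T d in \<open>auto intro: sym\<close>)
qed

lemma star_max_density:
  assumes S: "topological_tree S" "star S" and n: "n \<ge> card (leaves S)"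
  shows "max_density S n = 1"
proof -
  interpret topological S using S by (simp add: topological_iff)
  note sl = star_star_like[OF S(2)]
  then have k: "card (leaves S) \<ge> 2" unfolding star_like_def by simp
  then have T: "topological_tree (nat_star n)" and leaves: "leaves (nat_star n) = {1..n}"
    using n nat_star_topological[of n] nat_star_leaves[of n] by auto
  have "tree_density S (nat_star n) = 1"
  proof (rule tree_density_eq_1[OF S(1) T])
    fix L assume L: "L \<subseteq> leaves (nat_star n)" "card L = card (leaves S)"
    then have "star_like (nat_star n) 0 L"
      using k leaves by (intro nat_star_star_like) auto
    from star_like_iso[OF S(1) sl T this] show "tree_iso S (induced_tree (nat_star n) L)"
      using L induced_tree_leaves by simp
  qed (use n leaves in simp)
  then show ?thesis
    using max_density_eq_1[OF S(1) T] leaves by simp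
qed

lemma binary_caterpillar_max_density:
  assumes S: "topological_tree S" "binary_caterpillar S" and n: "n \<ge> card (leaves S)"
  shows "max_density S n = 1"
proof -
  interpret topological S using S by (simp add: topological_iff)
  obtain ls where ls: "comb S (top_vertex S) ls" "set ls = leaves S"
    using binary_caterpillar_comb[OF S(2)] by blast
  have len: "length ls = card (leaves S)"
    using comb_distinct[OF ls(1)] ls(2) by (metis distinct_card)
  have k: "card (leaves S) \<ge> 1"
    using leaves_nonempty finite_leaves by (simp add: Suc_le_eq card_gt_0_iff)
  let ?T = "nat_comb (n - 1)"
  have T: "topological_tree ?T" and card: "card (leaves ?T) = n"
    using n k nat_comb_topological card_nat_comb_leaves by auto
  have "tree_density S ?T = 1"
  proof (rule tree_density_eq_1[OF S(1) T])
    fix L assume L: "L \<subseteq> leaves ?T" "card L = card (leaves S)"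
    then have fin: "finite L" "L \<noteq> {}"
      using k card_ge_0_finite[of L] by auto
    let ?ms = "sorted_list_of_set L"
    obtain w where w: "comb ?T w ?ms"
      using nat_comb_comb[of ?ms "n - 1"] fin L by auto
    show "tree_iso S (induced_tree ?T L)"
      using comb_iso[OF S(1) ls(1) T w] len L fin ls(2) induced_tree_leaves by simp
  qed (use n card in simp)
  then show ?thesis
    using max_density_eq_1[OF S(1) T card] by simp
qed

theorem theorem4:
  fixes S :: "'a rtree"
  assumes "topological_tree S"
  shows "(star S \<or> binary_caterpillar S \<longrightarrow> inducibility S = 1) \<and>
         (\<not> star S \<and> \<not> binary_caterpillar S \<longrightarrow> inducibility S < 1)"
proof (intro conjI impI)
  assume "star S \<or> binary_caterpillar S"
  then have "max_density S n = 1" if "n \<ge> card (leaves S)" for n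
    using that star_max_density binary_caterpillar_max_density assms by blast
  then have "\<forall>\<^sub>F n in sequentially. ereal (max_density S n) = 1"
    by (intro eventually_sequentiallyI) simp
  then have "inducibility S = limsup (\<lambda>n. 1 :: ereal)"
    unfolding inducibility_def by (rule Limsup_eq)
  then show "inducibility S = 1"
    by (simp add: Limsup_const)
next
  assume S: "\<not> star S \<and> \<not> binary_caterpillar S"
  define k where "k = card (leaves S)"
  \<comment> \<open>The summand \<open>k ^ (k - 1)\<close> forces a star or a comb of size
    \<open>k\<close>; the summand \<open>k\<close> ensures \<open>k \<le> m\<close>, so
    \<open>m choose k\<close> is positive and the bound stays strictly below 1.\<close>
  define m where "m = k + k ^ (k - 1)"
  have "max_density S n \<le> 1 - 1 / real (m choose k)" if n: "n \<ge> m + 1" for n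
  proof (rule max_density_le[OF assms])
    show "n \<ge> 1" using n by simp
    fix T :: "nat rtree" assume T: "topological_tree T" "card (leaves T) = n"
    show "tree_density S T \<le> 1 - 1 / real (m choose k)"
      by (rule tree_density_bound[OF assms _ _ T(1) k_def]) (use S T n in \<open>auto simp: m_def\<close>)
  qed
  then have "inducibility S \<le> ereal (1 - 1 / real (m choose k))"
    unfolding inducibility_def by (intro Limsup_bounded eventually_sequentiallyI[of "m + 1"]) simp
  also have "\<dots> < 1"
    using zero_less_binomial[of k m] by (simp add: m_def one_ereal_def)
  finally show "inducibility S < 1" .
qed

end
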